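(* Let $\Gamma$ be a concave, strictly decreasing curve in the first quadrant with both intercepts equal to $L>0$, given by $y=f(x)$ with inverse function $x=g(y)$. Assume $(\alpha,\beta)\in\Gamma$ is a point with $\alpha,\beta>0$ such that $f\in C^2[0,\alpha]$ with $f'<0$ on $(0,\alpha]$ and $f''<0$ on $[0,\alpha]$, and similarly $g\in C^2[0,\beta]$ with $g'<0$ on $(0,\beta]$ and $g''<0$ on $[0,\beta]$. Further suppose $f''$ is monotonic on $[0,\alpha]$ and $g''$ is monotonic on $[0,\beta]$. Then the optimal stretch factor for maximizing $N(r,s)$ approaches $1$ as $r\to\infty$, with $$S(r)\subset\big[1-O(r^{-1/6}),\,1+O(r^{-1/6})\big]$$ (that is, there exist $C,r_0>0$ such that $|s-1|\le Cr^{-1/6}$ for all $r\ge r_0$ and all $s\in S(r)$), and the maximal lattice count satisfies $$\max_{s>0}N(r,s)=r^2\operatorname{Area}(\Gamma)-rL+O(r^{2/3})\qquad\text{as } r\to\infty .$$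
   Context: $\mathbb{N}=\{1,2,3,\dots\}$. The curve $\Gamma$ is the graph $y=f(x)$, $x\in[0,L]$, of a continuous, concave, strictly decreasing function $f:[0,L]\to[0,L]$ with $f(0)=L$ and $f(L)=0$; $g:[0,L]\to[0,L]$ is the inverse function of $f$. $\operatorname{Area}(\Gamma)$ is the area enclosed by $\Gamma$ and the coordinate axes. For $r,s>0$, the curve $r\Gamma(s)$ is the image of $\Gamma$ under $(x,y)\mapsto(rs^{-1}x,\,rsy)$, i.e. the graph of $x\mapsto rsf(sx/r)$ on $[0,rs^{-1}L]$. The number of positive-integer lattice points inside or on $r\Gamma(s)$ is $$N(r,s)=\#\{(j,k)\in\mathbb{N}\times\mathbb{N}: js/r\le L,\ k\le rsf(js/r)\}.$$ For each $r>0$ the function $s\mapsto N(r,s)$ attains its maximum over $s>0$, and $S(r)=\operatorname{arg\,max}_{s>0}N(r,s)$ denotes the set of all maximizing values of $s$. *)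

theory Defs
  imports "HOL-Analysis.Analysis" "HOL-Library.Landau_Symbols"
begin

definition curve :: "real \<Rightarrow> (real \<Rightarrow> real) \<Rightarrow> (real \<times> real) set" where
  "curve L f = (\<lambda>x. (x, f x)) ` {0..L}"

definition Area :: "real \<Rightarrow> (real \<Rightarrow> real) \<Rightarrow> real" where
  "Area L f = measure lebesgue {(x, y). 0 \<le> x \<and> x \<le> L \<and> 0 \<le> y \<and> y \<le> f x}"

text \<open>The derivatives are taken within \<open>S\<close>, so they are one-sided at the end points of a
  closed interval.\<close>

definition C2_on :: "real set \<Rightarrow> (real \<Rightarrow> real) \<Rightarrow> (real \<Rightarrow> real) \<Rightarrow> (real \<Rightarrow> real) \<Rightarrow> bool" where
  "C2_on S f f' f'' \<longleftrightarrow>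
     (\<forall>x\<in>S. (f has_real_derivative f' x) (at x within S)) \<and>
     (\<forall>x\<in>S. (f' has_real_derivative f'' x) (at x within S)) \<and>
     continuous_on S f''"

definition lattice_points :: "real \<Rightarrow> (real \<Rightarrow> real) \<Rightarrow> real \<Rightarrow> real \<Rightarrow> (nat \<times> nat) set" where
  "lattice_points L f r s =
     {(j, k). 1 \<le> j \<and> 1 \<le> k \<and> real j * s / r \<le> L \<and> real k \<le> r * s * f (real j * s / r)}"

definition lattice_count :: "real \<Rightarrow> (real \<Rightarrow> real) \<Rightarrow> real \<Rightarrow> real \<Rightarrow> nat" where
  "lattice_count L f r s = card (lattice_points L f r s)"

definition optimal_stretch :: "real \<Rightarrow> (real \<Rightarrow> real) \<Rightarrow> real \<Rightarrow> real set" where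
  "optimal_stretch L f r = {s. is_arg_max (lattice_count L f r) (\<lambda>s. s > 0) s}"

definition max_lattice_count :: "real \<Rightarrow> (real \<Rightarrow> real) \<Rightarrow> real \<Rightarrow> nat" where
  "max_lattice_count L f r = Max (lattice_count L f r ` {0<..})"

text \<open>\<open>card\<close> and \<open>Max\<close> are only meaningful on finite sets; the following facts show that the
  sets above are finite and that the maximum is attained.\<close>

lemma lattice_points_subset:
  assumes f: "\<And>x. x \<in> {0..L} \<Longrightarrow> f x \<in> {0..L}" and r: "r > 0" and s: "s > 0"
  shows "lattice_points L f r s \<subseteq> {..nat \<lfloor>(r * L)\<^sup>2\<rfloor>} \<times> {..nat \<lfloor>(r * L)\<^sup>2\<rfloor>}"
proof (clarify)
  fix j k assume "(j, k) \<in> lattice_points L f r s"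
  hence j: "1 \<le> j" and k: "1 \<le> k" and le: "real j * s / r \<le> L"
    and kf: "real k \<le> r * s * f (real j * s / r)"
    by (auto simp: lattice_points_def)
  have "f (real j * s / r) \<le> L"
    using f[of "real j * s / r"] le r s by auto
  hence "r * s * f (real j * s / r) \<le> r * s * L"
    using r s by (intro mult_left_mono) auto
  with kf have kL: "real k \<le> r * s * L" by linarith
  have jL: "real j * s \<le> r * L"
    using le r by (simp add: field_simps)
  have "s * (real j * real k) = (real j * s) * real k" by simp
  also have "\<dots> \<le> (r * L) * (r * s * L)"
  proof (rule mult_mono[OF jL kL])
    have "0 \<le> real j * s" using s by simp
    with jL show "0 \<le> r * L" by linarith
  qed simp
  also have "\<dots> = s * (r * L)\<^sup>2" by (simp add: power2_eq_square)
  finally have jk: "real (j * k) \<le> (r * L)\<^sup>2" using s by simp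
  have "real j \<le> real (j * k)" "real k \<le> real (j * k)"
    using j k by (simp_all flip: of_nat_mult)
  with jk have "real j \<le> (r * L)\<^sup>2" "real k \<le> (r * L)\<^sup>2" by linarith+
  thus "j \<in> {..nat \<lfloor>(r * L)\<^sup>2\<rfloor>} \<and> k \<in> {..nat \<lfloor>(r * L)\<^sup>2\<rfloor>}"
    by (auto intro: le_nat_floor)
qed

lemma finite_lattice_points:
  assumes "\<And>x. x \<in> {0..L} \<Longrightarrow> f x \<in> {0..L}" "r > 0" "s > 0"
  shows "finite (lattice_points L f r s)"
  using lattice_points_subset[OF assms] by (rule finite_subset) simp_all

lemma finite_range_lattice_count:
  assumes "\<And>x. x \<in> {0..L} \<Longrightarrow> f x \<in> {0..L}" "r > 0"
  shows "finite (lattice_count L f r ` {0<..})"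
proof -
  define M where "M = card ({..nat \<lfloor>(r * L)\<^sup>2\<rfloor>} \<times> {..nat \<lfloor>(r * L)\<^sup>2\<rfloor>})"
  have "lattice_count L f r ` {0<..} \<subseteq> {..M}"
  proof (rule image_subsetI, unfold atMost_iff)
    fix s :: real assume "s \<in> {0<..}"
    hence "s > 0" by simp
    from lattice_points_subset[OF assms this] show "lattice_count L f r s \<le> M"
      unfolding lattice_count_def M_def by (intro card_mono) simp_all
  qed
  thus ?thesis by (rule finite_subset) simp
qed

lemma optimal_stretch_nonempty:
  assumes "\<And>x. x \<in> {0..L} \<Longrightarrow> f x \<in> {0..L}" "r > 0"
  shows "optimal_stretch L f r \<noteq> {}"
proof -
  note fin = finite_range_lattice_count[OF assms]
  have "max_lattice_count L f r \<in> lattice_count L f r ` {0<..}"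
    unfolding max_lattice_count_def by (rule Max_in[OF fin]) (auto intro: exI[of _ 1])
  then obtain s where s: "s > 0" "lattice_count L f r s = max_lattice_count L f r" by auto
  have "lattice_count L f r t \<le> lattice_count L f r s" if "t > 0" for t
    using that fin unfolding s(2) max_lattice_count_def by (intro Max_ge) auto
  with s(1) have "s \<in> optimal_stretch L f r"
    by (force simp: optimal_stretch_def is_arg_max_def not_less[symmetric])
  thus ?thesis by blast
qed

end

theory Submission
  imports Defs
begin

text \<open>
  For a fixed compact range of stretch factors \<open>s\<close> the count has the two-term asymptotics
  \<open>N(r, s) = r\<^sup>2 Area - r L (s + 1/s) / 2 + O(r powr (2/3))\<close>, uniformly in \<open>s\<close>
  (lemma \<open>lattice_count_uniform_asymptotics\<close>). The second term is largest exactly for \<open>s = 1\<close>, where it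
  equals \<open>- r L\<close>, and \<open>s + 1/s - 2 = (s - 1)\<^sup>2 / s\<close>. Comparing an optimal \<open>s\<close> with \<open>s = 1\<close> therefore
  gives \<open>(s - 1)\<^sup>2 = O(r powr (-1/3))\<close> as well as the value of the maximum. That optimal stretch
  factors do stay in a compact range is a matter of convexity: summing over columns, a concave
  curve leaves at least a constant times \<open>r s\<close> of its area uncounted, and summing over rows at
  least a constant times \<open>r / s\<close> (lemma \<open>optimal_stretch_bounded\<close>).

  For the asymptotics the curve is cut at the given point \<open>(\<alpha>, \<beta>)\<close>. Lattice points to the left of it
  are counted by columns and those below it by rows; the points counted twice fill a rectangle.
  A column of height \<open>F j\<close> has \<open>\<lfloor>F j\<rfloor> = F j - 1/2 - (frac (F j) - 1/2)\<close> points. By concavity the sum of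
  the \<open>F j\<close> differs from the trapezoid value of the integral by \<open>O(1)\<close> (lemma
  \<open>concave_trapezoid_rule\<close>); the trapezoid correction for the columns is half the left edge of the
  region and that for the rows half its bottom edge, together \<open>r L (s + 1/s) / 2\<close>.

  It remains to see that the sum of the \<open>frac (F j) - 1/2\<close> is \<open>O(r powr (2/3))\<close>. There are \<open>O(r)\<close> terms
  and the second differences of \<open>F\<close> are of exact order \<open>1/r\<close>, so this is van der Corput's theorem
  (lemma \<open>sum_frac_second_difference\<close>). Its proof here uses finite Fourier analysis only. The values
  are rounded to multiples of \<open>1/M\<close>; on \<open>\<int>/M\<close> the sawtooth is a finite combination of characters, and
  averaging it over short intervals damps high frequencies at a small one-sided cost (lemma
  \<open>finite_erdos_turan\<close>). The exponential sums that appear are estimated by cutting them where the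
  increments pass an integer and applying the Kusmin-Landau inequality between the cuts (lemma
  \<open>second_difference_test\<close>).
\<close>

section \<open>Exponential sums over sequences with small second differences\<close>

text \<open>
  The additive character usually written \<open>e(x) = exp(2 \<pi> i x)\<close>.
\<close>

definition ee :: "real \<Rightarrow> complex" where
  "ee x = cis (2 * pi * x)"

lemma norm_ee [simp]: "norm (ee x) = 1"
  by (simp add: ee_def)

lemma ee_add: "ee (x + y) = ee x * ee y"
  by (simp add: ee_def cis_mult ring_distribs)

lemma ee_0 [simp]: "ee 0 = 1"
  by (simp add: ee_def)

lemma ee_of_int [simp]: "ee (of_int n) = 1"
  using cis_multiple_2pi[of "of_int n"] by (simp add: ee_def)

lemma cnj_ee: "cnj (ee x) = ee (- x)"
  by (simp add: ee_def cis_cnj)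

lemma ee_power: "ee x ^ n = ee (of_nat n * x)"
  by (induction n) (simp_all add: ring_distribs ee_add)

lemma one_minus_ee: "1 - ee x = Complex (2 * (sin (pi * x))\<^sup>2) (- (2 * sin (pi * x) * cos (pi * x)))"
proof -
  have "cos (2 * (pi * x)) = 1 - 2 * (sin (pi * x))\<^sup>2" by (rule cos_double_sin)
  moreover have "sin (2 * (pi * x)) = 2 * sin (pi * x) * cos (pi * x)" by (rule sin_double)
  ultimately show ?thesis by (simp add: ee_def complex_eq_iff mult.assoc)
qed

lemma norm_one_minus_ee: "norm (1 - ee x) = 2 * \<bar>sin (pi * x)\<bar>"
proof -
  have "(2 * s\<^sup>2)\<^sup>2 + (2 * s * c)\<^sup>2 = (2 * s)\<^sup>2 * (s\<^sup>2 + c\<^sup>2)" for s c :: real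
    by (simp add: power2_eq_square algebra_simps)
  hence "(2 * (sin (pi * x))\<^sup>2)\<^sup>2 + (2 * sin (pi * x) * cos (pi * x))\<^sup>2
      = (2 * sin (pi * x))\<^sup>2 * ((sin (pi * x))\<^sup>2 + (cos (pi * x))\<^sup>2)" .
  also have "\<dots> = (2 * sin (pi * x))\<^sup>2" by simp
  finally show ?thesis
    unfolding one_minus_ee complex_norm power2_minus by (simp only: real_sqrt_abs abs_mult)
qed

text \<open>
  The sine is concave on \<open>[0, \<pi>]\<close>, so it lies above its chord from \<open>0\<close> to \<open>\<pi>/2\<close>.
\<close>

lemma two_times_le_sin_pi:
  assumes "0 \<le> x" "x \<le> 1 / 2"
  shows "2 * x \<le> sin (pi * x)"
proof -
  have "concave_on {0..pi} sin"
    by (rule f''_le0_imp_concave[where f' = cos and f'' = "\<lambda>x. - sin x"])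
       (auto intro!: derivative_eq_intros simp: sin_ge_zero)
  from concave_onD[OF this, of "2 * x" 0 "pi / 2"] show ?thesis
    using assms by (simp add: mult.commute)
qed

lemma sin_cos_pi_shift:
  shows "sin (pi * x) = sin (pi * (x - of_int m)) * cos (of_int m * pi)"
    and "cos (pi * x) = cos (pi * (x - of_int m)) * cos (of_int m * pi)"
    and "\<bar>cos (of_int m * pi)\<bar> = 1"
proof -
  have eq: "pi * x = pi * (x - of_int m) + of_int m * pi" by (simp add: algebra_simps)
  have z: "sin (of_int m * pi) = 0" using sin_npi_int[of m] by (simp add: mult.commute)
  show "sin (pi * x) = sin (pi * (x - of_int m)) * cos (of_int m * pi)"
    by (subst eq, subst sin_add) (simp add: z)
  show "cos (pi * x) = cos (pi * (x - of_int m)) * cos (of_int m * pi)"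
    by (subst eq, subst cos_add) (simp add: z)
  show "\<bar>cos (of_int m * pi)\<bar> = 1"
    using sin_cos_squared_add[of "of_int m * pi"] z by (simp add: abs_square_eq_1)
qed

text \<open>
  Reduction to the previous bound by periodicity and the symmetry about \<open>1/2\<close>; \<open>d\<close> is a lower bound
  for the distance from \<open>x\<close> to the nearest integer.
\<close>

lemma two_times_le_abs_sin_pi:
  assumes "0 \<le> d" "of_int m + d \<le> x" "x \<le> of_int m + 1 - d"
  shows "2 * d \<le> \<bar>sin (pi * x)\<bar>"
proof -
  define t where "t = x - of_int m"
  have "\<bar>sin (pi * x)\<bar> = \<bar>sin (pi * t)\<bar>"
    using sin_cos_pi_shift(1)[of x m] sin_cos_pi_shift(3)[of m] by (simp add: t_def abs_mult)
  moreover have "2 * d \<le> sin (pi * t)"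
  proof (cases "t \<le> 1 / 2")
    case True
    with assms have "2 * t \<le> sin (pi * t)" by (intro two_times_le_sin_pi) (auto simp: t_def)
    with assms show ?thesis by (auto simp: t_def)
  next
    case False
    with assms have "2 * (1 - t) \<le> sin (pi * (1 - t))"
      by (intro two_times_le_sin_pi) (auto simp: t_def)
    also have "sin (pi * (1 - t)) = sin (pi * t)"
      by (simp add: right_diff_distrib sin_diff)
    finally show ?thesis using assms by (auto simp: t_def)
  qed
  ultimately show ?thesis by linarith
qed

text \<open>
  The real part of \<open>1 / (1 - e(x))\<close> is constant and its imaginary part is a cotangent, hence
  monotone between consecutive integers. So along a monotone sequence the total variation of
  \<open>1 / (1 - e(x))\<close> is the difference of its two extreme values.
\<close>

lemma inverse_one_minus_ee:
  assumes "sin (pi * x) \<noteq> 0"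
  shows "1 / (1 - ee x) = Complex (1 / 2) (cot (pi * x) / 2)"
proof -
  have "1 - ee x \<noteq> 0" using norm_one_minus_ee[of x] assms by auto
  moreover have "(1 - ee x) * Complex (1 / 2) (cot (pi * x) / 2) = 1"
    using assms sin_cos_squared_add[of "pi * x"] unfolding one_minus_ee
    by (simp add: complex_eq_iff cot_def field_simps power2_eq_square)
  ultimately show ?thesis by (simp add: field_simps)
qed

lemma cot_pi_antimono:
  assumes "of_int m < x" "x \<le> y" "y < of_int m + 1"
  shows "cot (pi * y) \<le> cot (pi * x)"
proof -
  have cotm: "cot (pi * z) = cot (pi * (z - of_int m))" for z
    using sin_cos_pi_shift(1,2)[of z m] sin_cos_pi_shift(3)[of m] by (auto simp: cot_def)
  define a b where "a = pi * (x - of_int m)" and "b = pi * (y - of_int m)"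
  have sa: "sin a > 0" using assms by (intro sin_gt_zero) (auto simp: a_def)
  have sb: "sin b > 0" using assms by (intro sin_gt_zero) (auto simp: b_def)
  have "a \<ge> 0" "b < pi" "a \<le> b" using assms by (auto simp: a_def b_def)
  hence "sin (b - a) \<ge> 0" by (intro sin_ge_zero) auto
  hence "cos b * sin a \<le> cos a * sin b" by (simp add: sin_diff mult.commute)
  hence "cot b \<le> cot a" using sa sb by (simp add: cot_def field_simps)
  thus ?thesis unfolding cotm[of x] cotm[of y] a_def b_def .
qed

text \<open>
  If the increments \<open>g n = y (n + 1) - y n\<close> stay at distance at least \<open>\<delta>\<close> from the integers, then
  \<open>e(y n) = (e(y n) - e(y (n + 1))) u n\<close> with \<open>u n = 1 / (1 - e(g n))\<close>, and summation by parts
  bounds the sum by the size and the total variation of \<open>u\<close>. Both are \<open>O(1/\<delta>)\<close>, the variation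
  because \<open>g\<close> is monotone. Working with increments instead of derivatives makes the argument
  purely discrete.
\<close>

lemma kusmin_landau:
  fixes y :: "nat \<Rightarrow> real"
  assumes ab: "a \<le> b" and d: "0 < \<delta>" 
    and lo: "\<And>n. n \<in> {a..b} \<Longrightarrow> of_int m + \<delta> \<le> y (Suc n) - y n"
    and hi: "\<And>n. n \<in> {a..b} \<Longrightarrow> y (Suc n) - y n \<le> of_int m + 1 - \<delta>"
    and mono: "\<And>n. a \<le> n \<Longrightarrow> n < b \<Longrightarrow> y (Suc n) - y n \<le> y (Suc (Suc n)) - y (Suc n)"
  shows "norm (\<Sum>n=a..b. ee (y n)) \<le> 1 / \<delta>"
proof -
  define g where "g n = y (Suc n) - y n" for n
  define u where "u n = 1 / (1 - ee (g n))" for n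
  define c where "c n = cot (pi * g n)" for n
  have sin_g: "2 * \<delta> \<le> \<bar>sin (pi * g n)\<bar>" if "n \<in> {a..b}" for n
    using lo[OF that] hi[OF that] d unfolding g_def by (intro two_times_le_abs_sin_pi) auto
  have u_c: "u n = Complex (1 / 2) (c n / 2)" if "n \<in> {a..b}" for n
    using sin_g[OF that] d unfolding u_def c_def by (intro inverse_one_minus_ee) auto
  have nu: "norm (u n) \<le> 1 / (4 * \<delta>)" if "n \<in> {a..b}" for n
    using sin_g[OF that] d unfolding u_def 
    by (auto simp: norm_divide norm_one_minus_ee intro!: divide_left_mono mult_pos_pos)
  have nc: "\<bar>c n\<bar> \<le> 1 / (2 * \<delta>)" if "n \<in> {a..b}" for n
    using sin_g[OF that] d unfolding c_def cot_def
    by (auto simp: abs_divide intro!: frac_le)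
  have step: "ee (y n) = (ee (y n) - ee (y (Suc n))) * u n" if "n \<in> {a..b}" for n
  proof -
    have "1 - ee (g n) \<noteq> 0" using norm_one_minus_ee[of "g n"] sin_g[OF that] d by auto
    moreover have "ee (y (Suc n)) = ee (y n) * ee (g n)"
      using ee_add[of "y n" "g n"] by (simp add: g_def)
    ultimately show ?thesis by (simp add: u_def field_simps)
  qed
  \<comment> \<open>Summation by parts, as an induction on the upper end. The second estimate adds the boundary term
    back, which is what the induction needs; the first one is the bound of interest.\<close>
  have "norm (\<Sum>n=a..N. ee (y n)) \<le> norm (u a) + norm (u N) + (c a - c N) / 2 \<and>
      norm ((\<Sum>n=a..N. ee (y n)) + ee (y (Suc N)) * u N) \<le> norm (u a) + (c a - c N) / 2"
    if "a \<le> N" "N \<le> b" for N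
    using that
  proof (induction N rule: dec_induct)
    case base
    have "(\<Sum>n=a..a. ee (y n)) + ee (y (Suc a)) * u a = ee (y a) * u a"
      using step[of a] ab by (simp add: algebra_simps)
    moreover have "norm (\<Sum>n=a..a. ee (y n)) \<le> norm (u a) + norm (u a)"
    proof -
      have "ee (y a) = ee (y a) * u a - ee (y (Suc a)) * u a"
        using step[of a] ab by (simp add: algebra_simps)
      hence "norm (ee (y a)) \<le> norm (ee (y a) * u a) + norm (ee (y (Suc a)) * u a)"
        by (metis norm_triangle_ineq4)
      thus ?thesis by (simp add: norm_mult)
    qed
    ultimately show ?case by (simp add: norm_mult)
  next
    case (step N)
    let ?S = "\<Sum>n=a..N. ee (y n)"
    have in_ab: "N \<in> {a..b}" "Suc N \<in> {a..b}" using step by auto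
    have cc: "c (Suc N) \<le> c N"
      unfolding c_def using lo[OF in_ab(1)] hi[OF in_ab(2)] mono[of N] step d
      by (intro cot_pi_antimono[of m]) (auto simp: g_def)
    have "u N - u (Suc N) = Complex 0 ((c N - c (Suc N)) / 2)"
      using u_c[OF in_ab(1)] u_c[OF in_ab(2)] by (simp add: complex_eq_iff diff_divide_distrib)
    hence nd: "norm (u N - u (Suc N)) = (c N - c (Suc N)) / 2"
      using cc by (simp add: complex_norm)
    have "?S + ee (y (Suc N)) + ee (y (Suc (Suc N))) * u (Suc N)
        = (?S + ee (y (Suc N)) * u N) - ee (y (Suc N)) * (u N - u (Suc N))"
      using \<open>\<And>n. n \<in> {a..b} \<Longrightarrow> ee (y n) = (ee (y n) - ee (y (Suc n))) * u n\<close>[OF in_ab(2)]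
      by (simp add: algebra_simps)
    also have "norm \<dots> \<le> norm (?S + ee (y (Suc N)) * u N) + norm (ee (y (Suc N)) * (u N - u (Suc N)))"
      by (rule norm_triangle_ineq4)
    also have "\<dots> \<le> norm (u a) + (c a - c (Suc N)) / 2"
      using step nd unfolding norm_mult norm_ee by (simp add: diff_divide_distrib)
    finally have 1: "norm (?S + ee (y (Suc N)) + ee (y (Suc (Suc N))) * u (Suc N)) 
      \<le> norm (u a) + (c a - c (Suc N)) / 2" .
    have "norm (?S + ee (y (Suc N))) \<le> norm (?S + ee (y (Suc N)) + ee (y (Suc (Suc N))) * u (Suc N))
       + norm (ee (y (Suc (Suc N))) * u (Suc N))"
      by (metis add_diff_cancel_right' norm_triangle_ineq4)
    hence "norm (?S + ee (y (Suc N))) \<le> norm (u a) + norm (u (Suc N)) + (c a - c (Suc N)) / 2"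
      using 1 by (simp add: norm_mult)
    with 1 step show ?case by simp
  qed
  from this[OF ab order.refl] have "norm (\<Sum>n=a..b. ee (y n)) \<le> norm (u a) + norm (u b) + (c a - c b) / 2"
    by simp
  also have "\<dots> \<le> 1 / (4 * \<delta>) + 1 / (4 * \<delta>) + (1 / (2 * \<delta>) + 1 / (2 * \<delta>)) / 2"
  proof -
    have "norm (u a) \<le> 1 / (4 * \<delta>)" "norm (u b) \<le> 1 / (4 * \<delta>)" using nu ab by auto
    moreover have "c a \<le> 1 / (2 * \<delta>)" "- c b \<le> 1 / (2 * \<delta>)"
      using nc[of a] nc[of b] ab by (auto simp: abs_le_iff)
    moreover have "p + q + (v - w) / 2 \<le> A + A + (B + B) / 2"
      if "p \<le> A" "q \<le> A" "v \<le> B" "- w \<le> B" for p q v w A B :: real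
    proof -
      have "(v - w) / 2 \<le> (B + B) / 2" using that by (intro divide_right_mono) auto
      with that show ?thesis by (intro add_mono)
    qed
    ultimately show ?thesis by blast
  qed
  also have "\<dots> = 1 / \<delta>" using d by (simp add: field_simps)
  finally show ?thesis .
qed

lemma card_le_if_spaced:
  fixes g :: "nat \<Rightarrow> real"
  assumes fin: "finite T" and mu: "0 < \<mu>" and w: "0 \<le> w"
    and spaced: "\<And>i j. i \<in> T \<Longrightarrow> j \<in> T \<Longrightarrow> i \<le> j \<Longrightarrow> \<mu> * real (j - i) \<le> g j - g i"
    and range: "\<And>i. i \<in> T \<Longrightarrow> c \<le> g i \<and> g i \<le> c + w"
  shows "real (card T) \<le> w / \<mu> + 1"
proof (cases "T = {}")
  case True
  thus ?thesis using mu w by simp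
next
  case False
  define i j where "i = Min T" and "j = Max T"
  have ij: "i \<in> T" "j \<in> T" "i \<le> j" using fin False by (auto simp: i_def j_def)
  have "T \<subseteq> {i..j}" using fin by (auto simp: i_def j_def)
  hence "card T \<le> card {i..j}" by (intro card_mono) auto
  hence "real (card T) \<le> real (j - i) + 1" using ij by simp
  moreover have "\<mu> * real (j - i) \<le> w"
    using spaced[OF ij] range[OF ij(1)] range[OF ij(2)] by linarith
  hence "real (j - i) \<le> w / \<mu>" using mu by (simp add: field_simps)
  ultimately show ?thesis by linarith
qed

text \<open>
  The increments \<open>g\<close> of \<open>y\<close> grow by at least \<open>\<mu>\<close> and at most \<open>h \<mu>\<close> per step, so over \<open>N\<close> steps they
  visit at most \<open>h \<mu> N + 2\<close> unit intervals \<open>[m, m + 1)\<close>. Inside such an interval the indices whose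
  increment is within \<open>\<delta>\<close> of an end point are few, at most \<open>\<delta>/\<mu> + 1\<close> at either end, and are
  estimated trivially; the others form an interval of indices to which the Kusmin-Landau
  inequality applies, contributing \<open>1/\<delta>\<close>. The choice \<open>\<delta> = sqrt \<mu>\<close> balances the two.
\<close>

lemma second_difference_test_small:
  fixes y :: "nat \<Rightarrow> real"
  assumes mu: "0 < \<mu>" "\<mu> \<le> 1 / 4" and h: "1 \<le> h"
    and sd: "\<And>n. n + 2 \<le> N \<Longrightarrow> \<mu> \<le> y (n + 2) - 2 * y (n + 1) + y n"
            "\<And>n. n + 2 \<le> N \<Longrightarrow> y (n + 2) - 2 * y (n + 1) + y n \<le> h * \<mu>"
  shows "norm (\<Sum>n<N. ee (y n)) \<le> (h * \<mu> * real N + 2) * (4 / sqrt \<mu>)"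
proof (cases "N = 0")
  case True
  thus ?thesis using mu by simp
next
  case False
  define g where "g n = y (Suc n) - y n" for n
  define \<delta> where "\<delta> = sqrt \<mu>"
  have d: "0 < \<delta>" "\<delta> * \<delta> = \<mu>" using mu by (auto simp: \<delta>_def)
  have d_half: "\<delta> \<le> 1 / 2"
    using real_sqrt_le_mono[OF mu(2)] by (simp add: \<delta>_def real_sqrt_divide)
  have step: "\<mu> \<le> g (Suc n) - g n" "g (Suc n) - g n \<le> h * \<mu>" if "Suc n < N" for n
    using sd[of n] that by (auto simp: g_def)
  have spaced: "\<mu> * real (j - i) \<le> g j - g i \<and> g j - g i \<le> h * \<mu> * real (j - i)"
    if "i \<le> j" "j < N" for i j
    using that
  proof (induction j rule: dec_induct)
    case base
    thus ?case by simp
  next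
    case (step j)
    have "real (Suc j - i) = real (j - i) + 1" using step by simp
    thus ?case using step step(3) \<open>\<And>n. Suc n < N \<Longrightarrow> \<mu> \<le> g (Suc n) - g n\<close>[of j]
        \<open>\<And>n. Suc n < N \<Longrightarrow> g (Suc n) - g n \<le> h * \<mu>\<close>[of j]
      by (simp add: ring_distribs)
  qed
  have g_mono: "g i \<le> g j" if "i \<le> j" "j < N" for i j
    using spaced[OF that] mu by (smt (verit) mult_nonneg_nonneg of_nat_0_le_iff)
  define B where "B m = {n \<in> {..<N}. \<lfloor>g n\<rfloor> = m}" for m
  define R where "R = (\<lambda>n. \<lfloor>g n\<rfloor>) ` {..<N}"
  have block: "norm (\<Sum>n\<in>B m. ee (y n)) \<le> 4 / \<delta>" for m
  proof -
    define T1 where "T1 = {n \<in> B m. g n < of_int m + \<delta>}"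
    define T2 where "T2 = {n \<in> B m. of_int m + \<delta> \<le> g n \<and> g n \<le> of_int m + 1 - \<delta>}"
    define T3 where "T3 = {n \<in> B m. of_int m + \<delta> \<le> g n \<and> of_int m + 1 - \<delta> < g n}"
    have fin: "finite (B m)" by (simp add: B_def)
    have Bm: "n \<in> B m \<Longrightarrow> n < N \<and> of_int m \<le> g n \<and> g n < of_int m + 1" for n
      by (auto simp: B_def floor_eq_iff)
    have card_T: "real (card T) \<le> \<delta> / \<mu> + 1" 
      if "T \<subseteq> B m" "\<And>n. n \<in> T \<Longrightarrow> c \<le> g n \<and> g n \<le> c + \<delta>" for T c
    proof (rule card_le_if_spaced[of T \<mu> \<delta> g c])
      show "finite T" using that(1) fin by (rule finite_subset)
      show "\<mu> * real (j - i) \<le> g j - g i" if "i \<in> T" "j \<in> T" "i \<le> j" for i j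
        using spaced[of i j] that \<open>T \<subseteq> B m\<close> Bm by blast
    qed (use mu d that in auto)
    have triv: "norm (\<Sum>n\<in>T. ee (y n)) \<le> real (card T)" for T
      using norm_sum[of "\<lambda>n. ee (y n)" T] by simp
    have 1: "norm (\<Sum>n\<in>T1. ee (y n)) \<le> \<delta> / \<mu> + 1"
      by (rule order_trans[OF triv card_T[of _ "of_int m"]]) (use Bm in \<open>force simp: T1_def\<close>)+
    have 3: "norm (\<Sum>n\<in>T3. ee (y n)) \<le> \<delta> / \<mu> + 1"
      by (rule order_trans[OF triv card_T[of _ "of_int m + 1 - \<delta>"]]) (use Bm in \<open>force simp: T3_def\<close>)+
    have 2: "norm (\<Sum>n\<in>T2. ee (y n)) \<le> 1 / \<delta>"
    proof (cases "T2 = {}")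
      case True
      thus ?thesis using d by simp
    next
      case False
      have finT: "finite T2" using fin by (simp add: T2_def)
      define a b where "a = Min T2" and "b = Max T2"
      have ab: "a \<in> T2" "b \<in> T2" "a \<le> b" using finT False by (auto simp: a_def b_def)
      have bN: "b < N" using ab Bm by (auto simp: T2_def)
      have in_ab: "of_int m + \<delta> \<le> g n \<and> g n \<le> of_int m + 1 - \<delta>" if "n \<in> {a..b}" for n
        using g_mono[of a n] g_mono[of n b] that ab bN by (auto simp: T2_def)
      have "T2 = {a..b}"
      proof
        show "T2 \<subseteq> {a..b}" using finT by (auto simp: a_def b_def)
        show "{a..b} \<subseteq> T2"
        proof
          fix n assume n: "n \<in> {a..b}"
          have "\<lfloor>g n\<rfloor> = m" using in_ab[OF n] d by (simp add: floor_eq_iff)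
          thus "n \<in> T2" using in_ab[OF n] n bN by (auto simp: T2_def B_def)
        qed
      qed
      moreover have "norm (\<Sum>n=a..b. ee (y n)) \<le> 1 / \<delta>"
      proof (rule kusmin_landau[of a b \<delta> m y])
        show "y (Suc n) - y n \<le> y (Suc (Suc n)) - y (Suc n)" if "a \<le> n" "n < b" for n
          using step(1)[of n] that bN mu by (auto simp: g_def)
      qed (use ab d in_ab in \<open>auto simp: g_def\<close>)
      ultimately show ?thesis by simp
    qed
    have "B m = T1 \<union> (T2 \<union> T3)" by (auto simp: T1_def T2_def T3_def)
    moreover have "T1 \<inter> (T2 \<union> T3) = {}" "T2 \<inter> T3 = {}" by (auto simp: T1_def T2_def T3_def)
    moreover have "finite T1" "finite T2" "finite T3" using fin by (auto simp: T1_def T2_def T3_def)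
    ultimately have "(\<Sum>n\<in>B m. ee (y n)) = (\<Sum>n\<in>T1. ee (y n)) + ((\<Sum>n\<in>T2. ee (y n)) + (\<Sum>n\<in>T3. ee (y n)))"
      by (simp add: sum.union_disjoint)
    hence "norm (\<Sum>n\<in>B m. ee (y n)) \<le> (\<delta> / \<mu> + 1) + (1 / \<delta> + (\<delta> / \<mu> + 1))"
      using 1 2 3 by (simp only:) (intro norm_triangle_le add_mono; assumption)
    also have "\<delta> / \<mu> = 1 / \<delta>" using d mu by (simp add: field_simps)
    also have "1 \<le> 1 / (2 * \<delta>)" using d d_half by (simp add: field_simps)
    hence "(1 / \<delta> + 1) + (1 / \<delta> + (1 / \<delta> + 1)) \<le> 4 / \<delta>" by (simp add: field_simps)
    finally show ?thesis .
  qed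
  have cardR: "real (card R) \<le> h * \<mu> * real N + 2"
  proof -
    define w where "w = h * \<mu> * real N"
    have w0: "w \<ge> 0" using h mu by (simp add: w_def)
    have "R \<subseteq> {\<lfloor>g 0\<rfloor>..\<lfloor>g 0 + w\<rfloor>}"
    proof
      fix m assume "m \<in> R"
      then obtain n where n: "n < N" "m = \<lfloor>g n\<rfloor>" by (auto simp: R_def)
      have "g n - g 0 \<le> h * \<mu> * real n" using spaced[of 0 n] n by simp
      also have "\<dots> \<le> w" unfolding w_def using n h mu by (intro mult_left_mono) auto
      finally have "g n \<le> g 0 + w" by simp
      thus "m \<in> {\<lfloor>g 0\<rfloor>..\<lfloor>g 0 + w\<rfloor>}" using g_mono[of 0 n] n by (auto intro: floor_mono)
    qed
    hence "card R \<le> card {\<lfloor>g 0\<rfloor>..\<lfloor>g 0 + w\<rfloor>}" by (intro card_mono) auto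
    hence "int (card R) \<le> \<lfloor>g 0 + w\<rfloor> - \<lfloor>g 0\<rfloor> + 1"
      using floor_mono[of "g 0" "g 0 + w"] w0 by simp
    hence "real (card R) \<le> of_int (\<lfloor>g 0 + w\<rfloor> - \<lfloor>g 0\<rfloor> + 1)" by (metis of_int_le_iff of_int_of_nat_eq)
    also have "\<dots> \<le> w + 2" by simp linarith
    finally show ?thesis by (simp add: w_def)
  qed
  have "(\<Sum>n<N. ee (y n)) = (\<Sum>m\<in>R. \<Sum>n\<in>B m. ee (y n))"
    unfolding R_def B_def by (rule sum.image_gen) simp
  hence "norm (\<Sum>n<N. ee (y n)) \<le> (\<Sum>m\<in>R. 4 / \<delta>)"
    by (simp only:) (rule sum_norm_le, rule block)
  also have "\<dots> = real (card R) * (4 / \<delta>)" by simp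
  also have "\<dots> \<le> (h * \<mu> * real N + 2) * (4 / \<delta>)"
    using cardR d by (intro mult_right_mono) auto
  finally show ?thesis by (simp add: \<delta>_def)
qed

text \<open>
  For \<open>\<mu> > 1/4\<close> the trivial bound \<open>N\<close> does not exceed the right-hand side.
\<close>

lemma second_difference_test:
  fixes y :: "nat \<Rightarrow> real"
  assumes mu: "0 < \<mu>" and h: "1 \<le> h"
    and sd: "\<And>n. n + 2 \<le> N \<Longrightarrow> \<mu> \<le> y (n + 2) - 2 * y (n + 1) + y n"
            "\<And>n. n + 2 \<le> N \<Longrightarrow> y (n + 2) - 2 * y (n + 1) + y n \<le> h * \<mu>"
  shows "norm (\<Sum>n<N. ee (y n)) \<le> 4 * h * real N * sqrt \<mu> + 8 / sqrt \<mu>"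
proof (cases "\<mu> \<le> 1 / 4")
  case True
  have "norm (\<Sum>n<N. ee (y n)) \<le> (h * \<mu> * real N + 2) * (4 / sqrt \<mu>)"
    using second_difference_test_small[OF mu True h sd] .
  also have "\<dots> = 4 * h * real N * (\<mu> / sqrt \<mu>) + 8 / sqrt \<mu>"
    by (simp add: algebra_simps add_divide_distrib)
  finally show ?thesis using mu by (simp add: real_div_sqrt)
next
  case False
  have "1 / 2 \<le> sqrt \<mu>" using False by (intro real_le_rsqrt) (simp add: power2_eq_square)
  hence "1 * (1 / 2) \<le> h * sqrt \<mu>" using h by (intro mult_mono) auto
  hence "real N * 1 \<le> real N * (4 * (h * sqrt \<mu>))" by (intro mult_left_mono) auto
  moreover have "norm (\<Sum>n<N. ee (y n)) \<le> real N"
    using norm_sum[of "\<lambda>n. ee (y n)" "{..<N}"] by simp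
  moreover have "0 \<le> 8 / sqrt \<mu>" using mu by simp
  moreover have "real N * (4 * (h * sqrt \<mu>)) = 4 * h * real N * sqrt \<mu>" by simp
  ultimately show ?thesis by linarith
qed

section \<open>The sawtooth on the integers modulo M\<close>

text \<open>
  The fractional part of \<open>j / M\<close>. On the finite group \<open>\<int>/M\<close> its Fourier expansion is a finite sum, so
  no question of convergence arises.
\<close>

definition sawtooth :: "nat \<Rightarrow> int \<Rightarrow> real" where
  "sawtooth M j = real_of_int (j mod int M) / real M"

lemma sawtooth_diff:
  assumes "M > 0"
  shows "sawtooth M j - sawtooth M (j - 1) = 1 / real M - (if int M dvd j then 1 else 0)"
proof -
  define q r where "q = j div int M" and "r = j mod int M"
  have j: "j = int M * q + r" "0 \<le> r" "r < int M" using assms by (auto simp: q_def r_def)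
  show ?thesis
  proof (cases "r = 0")
    case True
    have "(j - 1) mod int M = ((q - 1) * int M + (int M - 1)) mod int M"
      using j True by (simp add: algebra_simps)
    also have "\<dots> = (int M - 1) mod int M" by (rule mod_mult_self3)
    also have "\<dots> = int M - 1" using assms by (intro mod_pos_pos_trivial) auto
    finally have "(j - 1) mod int M = int M - 1" .
    moreover have "j mod int M = 0" "int M dvd j" using True by (auto simp: r_def)
    ultimately show ?thesis using assms by (simp add: sawtooth_def diff_divide_distrib)
  next
    case False
    have "(j - 1) mod int M = (int M * q + (r - 1)) mod int M" using j(1) by (simp only: add_diff_eq)
    also have "\<dots> = (r - 1) mod int M" by simp
    also have "\<dots> = r - 1" using j(2,3) False by (intro mod_pos_pos_trivial) auto
    finally have "(j - 1) mod int M = r - 1" .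
    moreover have "\<not> int M dvd j" using False by (simp add: r_def dvd_eq_mod_eq_0)
    ultimately show ?thesis by (simp add: sawtooth_def r_def diff_divide_distrib)
  qed
qed

lemma sawtooth_shift_le:
  assumes "M > 0"
  shows "sawtooth M j \<le> sawtooth M (j - int t) + real t / real M"
proof (induction t)
  case (Suc t)
  have "sawtooth M (j - int t) - sawtooth M (j - int t - 1) \<le> 1 / real M"
    using sawtooth_diff[OF assms, of "j - int t"] by auto
  moreover have "j - int (Suc t) = j - int t - 1" by simp
  moreover have "real (Suc t) / real M = real t / real M + 1 / real M"
    by (simp add: add_divide_distrib)
  ultimately show ?case using Suc by (simp only:)
qed simp

lemma sum_ee_roots:
  assumes M: "M > 0"
  shows "(\<Sum>k<M. ee (real k * of_int j / real M)) = (if int M dvd j then of_nat M else 0)"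
proof -
  define z where "z = ee (of_int j / real M)"
  have zk: "ee (real k * of_int j / real M) = z ^ k" for k
    by (simp add: z_def ee_power)
  show ?thesis
  proof (cases "int M dvd j")
    case True
    then obtain q where "j = int M * q" by blast
    hence "z = ee (of_int q)" using M by (simp add: z_def)
    hence "z = 1" by simp
    thus ?thesis using True by (simp add: zk)
  next
    case False
    have "z ^ M = 1" using M by (simp add: z_def ee_power)
    moreover have "z \<noteq> 1"
    proof
      assume "z = 1"
      hence "norm (1 - z) = 0" by simp
      hence "sin (pi * (of_int j / real M)) = 0" unfolding z_def norm_one_minus_ee by simp
      then obtain i :: int where "pi * (of_int j / real M) = of_int i * pi"
        unfolding sin_zero_iff_int2 by blast
      hence "of_int j = of_int i * real M" using M by (simp add: field_simps)
      hence "j = i * int M" by (metis of_int_eq_iff of_int_mult of_int_of_nat_eq)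
      thus False using False by simp
    qed
    ultimately have "(\<Sum>k<M. z ^ k) = 0" by (simp add: geometric_sum)
    thus ?thesis using False by (simp add: zk)
  qed
qed

text \<open>
  The \<open>k\<close>-th Fourier coefficient of the sawtooth on \<open>\<int>/M\<close>, for \<open>0 < k < M\<close>.
\<close>

definition saw_coeff :: "nat \<Rightarrow> nat \<Rightarrow> complex" where
  "saw_coeff M k = - 1 / (of_nat M * (1 - ee (- real k / real M)))"

lemma norm_one_minus_ee_ge:
  assumes "0 < k" "k < M"
  shows "4 * real (min k (M - k)) / real M \<le> norm (1 - ee (- real k / real M))"
proof -
  define d where "d = real (min k (M - k)) / real M"
  have "2 * d \<le> \<bar>sin (pi * (- real k / real M))\<bar>"
    by (rule two_times_le_abs_sin_pi[where m = "-1"])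
       (use assms in \<open>auto simp: d_def field_simps min_def of_nat_diff\<close>)
  thus ?thesis unfolding norm_one_minus_ee d_def by simp
qed

lemma one_minus_ee_nonzero:
  assumes "0 < k" "k < M"
  shows "1 - ee (- real k / real M) \<noteq> 0"
proof -
  have "0 < 4 * real (min k (M - k)) / real M" using assms by auto
  with norm_one_minus_ee_ge[OF assms] show ?thesis by force
qed

text \<open>
  The difference \<open>sawtooth j - sawtooth (j - 1)\<close> is \<open>1/M\<close> minus the indicator of \<open>M dvd j\<close>, which is
  \<open>- 1/M\<close> times the sum of the nontrivial characters. Dividing the character \<open>k\<close> by the factor
  \<open>1 - e(-k/M)\<close> by which differencing acts on it gives the expansion up to a constant, and the
  constant is the mean value over a period.
\<close>

lemma sawtooth_fourier:
  assumes M: "M > 0"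
  shows "complex_of_real (sawtooth M j) = of_real ((real M - 1) / (2 * real M))
     + (\<Sum>k=1..<M. saw_coeff M k * ee (real k * of_int j / real M))"
proof -
  define q where "q j = (\<Sum>k=1..<M. saw_coeff M k * ee (real k * of_int j / real M))" for j :: int
  have split0: "(\<Sum>k<M. F k) = F 0 + (\<Sum>k=1..<M. F k)" for F :: "nat \<Rightarrow> complex"
    using M by (simp add: lessThan_atLeast0 sum.atLeast_Suc_lessThan)
  have qdiff: "q j - q (j - 1) = of_real (sawtooth M j - sawtooth M (j - 1))" for j
  proof -
    have "q j - q (j - 1) = (\<Sum>k=1..<M. - ee (real k * of_int j / real M) / of_nat M)"
      unfolding q_def sum_subtractf[symmetric]
    proof (rule sum.cong[OF refl])
      fix k assume k: "k \<in> {1..<M}"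
      have "real k * of_int (j - 1) / real M = real k * of_int j / real M + (- real k / real M)"
        by (simp add: right_diff_distrib diff_divide_distrib)
      hence "ee (real k * of_int (j - 1) / real M) = ee (real k * of_int j / real M) * ee (- real k / real M)"
        by (simp only: ee_add)
      hence "saw_coeff M k * ee (real k * of_int j / real M) - saw_coeff M k * ee (real k * of_int (j - 1) / real M)
         = saw_coeff M k * (1 - ee (- real k / real M)) * ee (real k * of_int j / real M)"
        by (simp add: algebra_simps)
      also have "saw_coeff M k * (1 - ee (- real k / real M)) = - 1 / of_nat M"
        using one_minus_ee_nonzero[of k M] k by (simp add: saw_coeff_def)
      finally show "saw_coeff M k * ee (real k * of_int j / real M) - saw_coeff M k * ee (real k * of_int (j - 1) / real M)
         = - ee (real k * of_int j / real M) / of_nat M" by simp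
    qed
    also have "\<dots> = - (\<Sum>k=1..<M. ee (real k * of_int j / real M)) / of_nat M"
      by (simp add: sum_negf sum_divide_distrib)
    also have "(\<Sum>k=1..<M. ee (real k * of_int j / real M)) = (if int M dvd j then of_nat M else 0) - 1"
      using split0[of "\<lambda>k. ee (real k * of_int j / real M)"] sum_ee_roots[OF M, of j] by simp
    finally show ?thesis unfolding sawtooth_diff[OF M] using M
      by (auto simp: diff_divide_distrib)
  qed
  define C where "C = of_real (sawtooth M 0) - q 0"
  have const: "of_real (sawtooth M (int n)) = C + q (int n)" for n
  proof (induction n)
    case (Suc n)
    have "int (Suc n) - 1 = int n" by simp
    hence "q (int (Suc n)) - q (int n) = of_real (sawtooth M (int (Suc n))) - of_real (sawtooth M (int n))"
      using qdiff[of "int (Suc n)"] by simp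
    with Suc show ?case by (simp add: algebra_simps)
  qed (simp add: C_def)
  have sumq: "(\<Sum>n<M. q (int n)) = 0"
  proof -
    have "(\<Sum>n<M. q (int n)) = (\<Sum>k=1..<M. \<Sum>n<M. saw_coeff M k * ee (real k * of_int (int n) / real M))"
      unfolding q_def by (rule sum.swap)
    also have "\<dots> = (\<Sum>k=1..<M. saw_coeff M k * (\<Sum>n<M. ee (real n * of_int (int k) / real M)))"
      by (simp add: sum_distrib_left mult_ac)
    also have "\<dots> = 0"
    proof (intro sum.neutral ballI)
      fix k assume "k \<in> {1..<M}"
      hence "\<not> int M dvd int k" by (auto dest: nat_dvd_not_less)
      thus "saw_coeff M k * (\<Sum>n<M. ee (real n * of_int (int k) / real M)) = 0"
        by (simp only: sum_ee_roots[OF M] if_False mult_zero_right)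
    qed
    finally show ?thesis .
  qed
  have "(\<Sum>n<M. sawtooth M (int n)) = (real M - 1) / 2"
  proof -
    have "(\<Sum>n<M. sawtooth M (int n)) = (\<Sum>n<M. real n / real M)"
      by (intro sum.cong refl) (simp add: sawtooth_def flip: of_nat_mod)
    also have "\<dots> = (\<Sum>n<M. real n) / real M" by (simp add: sum_divide_distrib)
    also have "(\<Sum>n<M. real n) = real M * (real M - 1) / 2"
      by (induction M) (auto simp: field_simps)
    finally show ?thesis using M by simp
  qed
  moreover have "of_real (\<Sum>n<M. sawtooth M (int n)) = of_nat M * C + (\<Sum>n<M. q (int n))"
    by (simp add: const sum.distrib)
  ultimately have "of_nat M * C = of_real ((real M - 1) / 2)" using sumq by (simp only:) simp
  hence "C = of_real ((real M - 1) / 2) / of_nat M"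
    using M by (metis nonzero_mult_div_cancel_left of_nat_eq_0_iff less_numeral_extra(3))
  hence "C = of_real ((real M - 1) / (2 * real M))" by simp
  moreover have "of_real (sawtooth M j) = C + q j"
  proof -
    define n where "n = nat (j mod int M)"
    have n: "int n = j mod int M" using M by (simp add: n_def)
    have "sawtooth M j = sawtooth M (int n)" by (simp add: sawtooth_def n)
    moreover have "q j = q (int n)"
      unfolding q_def
    proof (intro sum.cong refl)
      fix k
      have "of_int j = real M * of_int (j div int M) + of_int (int n)"
        unfolding n by (metis mult_div_mod_eq of_int_add of_int_mult of_int_of_nat_eq)
      hence "real k * of_int j / real M = of_int (int k * (j div int M)) + real k * of_int (int n) / real M"
        using M by (simp add: field_simps)
      thus "saw_coeff M k * ee (real k * of_int j / real M) = saw_coeff M k * ee (real k * of_int (int n) / real M)"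
        by (simp only: ee_add ee_of_int mult_1)
    qed
    ultimately show ?thesis using const by simp
  qed
  ultimately show ?thesis by (simp add: q_def)
qed

text \<open>
  The sawtooth rises with slope \<open>1/M\<close> between its drops, so its value at \<open>j\<close> exceeds its average over
  \<open>j, j - 1, ..., j - d + 1\<close> by at most \<open>d/M = 1/K\<close>. With \<open>\<kappa> = min k (M - k)\<close>, averaging
  multiplies the \<open>k\<close>-th coefficient, of size at most \<open>1/(4 \<kappa>)\<close>, by a geometric mean \<open>w k\<close> of size at
  most \<open>min 1 (K/\<kappa>)\<close>; without this factor the frequencies beyond \<open>K\<close> would dominate. As \<open>k\<close> and \<open>M - k\<close>
  give conjugate exponential sums, the bounds \<open>H\<close> only enter at \<open>\<kappa>\<close>. The bound is one-sided; the
  opposite one follows by applying it to the reflected sequence \<open>- a n - 1\<close>.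
\<close>

lemma finite_erdos_turan:
  fixes a :: "nat \<Rightarrow> int"
  assumes M: "M = K * d" and K: "K > 0" and d: "d > 0"
    and H: "\<And>k. 1 \<le> k \<Longrightarrow> k < M \<Longrightarrow> norm (\<Sum>n<N. ee (real k * of_int (a n) / real M)) \<le> H k"
  shows "(\<Sum>n<N. sawtooth M (a n)) - real N * ((real M - 1) / (2 * real M))
     \<le> real N / real K + (\<Sum>k=1..<M. min 1 (real K / real k) / real k * H k) / 2"
proof -
  have M0: "M > 0" using M K d by simp
  have MK: "real M = real K * real d" using M by simp
  define mean where "mean = (real M - 1) / (2 * real M)"
  define w where "w k = (\<Sum>t<d. ee (- real k / real M) ^ t) / of_nat d" for k
  define S where "S k = (\<Sum>n<N. ee (real k * of_int (a n) / real M))" for k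
  define b where "b k = min 1 (real K / real k) / real k * H k / 4" for k
  have pointwise: "sawtooth M j \<le> (\<Sum>t<d. sawtooth M (j - int t)) / real d + 1 / real K" for j
  proof -
    have "(\<Sum>t<d. sawtooth M j) \<le> (\<Sum>t<d. sawtooth M (j - int t) + 1 / real K)"
    proof (rule sum_mono)
      fix t assume t: "t \<in> {..<d}"
      have "real t / real M \<le> real d / real M" using t by (intro divide_right_mono) auto
      also have "\<dots> = 1 / real K" using d MK by simp
      finally show "sawtooth M j \<le> sawtooth M (j - int t) + 1 / real K"
        using sawtooth_shift_le[OF M0, of j t] by linarith
    qed
    hence "real d * sawtooth M j \<le> (\<Sum>t<d. sawtooth M (j - int t)) + real d / real K"
      by (simp add: sum.distrib)
    thus ?thesis using d by (simp add: field_simps)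
  qed
  have avg: "complex_of_real ((\<Sum>t<d. sawtooth M (j - int t)) / real d)
     = of_real mean + (\<Sum>k=1..<M. saw_coeff M k * w k * ee (real k * of_int j / real M))" for j
  proof -
    have "complex_of_real (\<Sum>t<d. sawtooth M (j - int t))
       = of_nat d * of_real mean + (\<Sum>t<d. \<Sum>k=1..<M. saw_coeff M k * ee (real k * of_int (j - int t) / real M))"
      by (simp only: of_real_sum sawtooth_fourier[OF M0] sum.distrib mean_def[symmetric] sum_constant card_lessThan)
    also have "(\<Sum>t<d. \<Sum>k=1..<M. saw_coeff M k * ee (real k * of_int (j - int t) / real M))
       = (\<Sum>k=1..<M. \<Sum>t<d. saw_coeff M k * ee (real k * of_int (j - int t) / real M))"
      by (rule sum.swap)
    also have "\<dots> = (\<Sum>k=1..<M. of_nat d * (saw_coeff M k * w k * ee (real k * of_int j / real M)))"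
    proof (intro sum.cong refl)
      fix k
      have "real k * of_int (j - int t) / real M = real k * of_int j / real M + of_nat t * (- real k / real M)" for t
        by (simp add: right_diff_distrib diff_divide_distrib)
      hence "ee (real k * of_int (j - int t) / real M) = ee (real k * of_int j / real M) * ee (- real k / real M) ^ t" for t
        by (simp only: ee_add ee_power)
      hence "(\<Sum>t<d. saw_coeff M k * ee (real k * of_int (j - int t) / real M))
        = saw_coeff M k * ee (real k * of_int j / real M) * (\<Sum>t<d. ee (- real k / real M) ^ t)"
        by (simp only: sum_distrib_left mult.assoc)
      also have "(\<Sum>t<d. ee (- real k / real M) ^ t) = of_nat d * w k" using d by (simp add: w_def)
      finally show "(\<Sum>t<d. saw_coeff M k * ee (real k * of_int (j - int t) / real M))
        = of_nat d * (saw_coeff M k * w k * ee (real k * of_int j / real M))"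
        by (simp only: mult_ac)
    qed
    finally show ?thesis using d
      by (simp add: sum_distrib_left[symmetric] add_divide_distrib)
  qed
  have nc: "norm (saw_coeff M k * w k) \<le> min 1 (real K / real \<kappa>) / (4 * real \<kappa>)"
    if k: "1 \<le> k" "k < M" and \<kappa>: "\<kappa> = min k (M - k)" for k \<kappa>
  proof -
    define D where "D = norm (1 - ee (- real k / real M))"
    have \<kappa>0: "real \<kappa> > 0" using k \<kappa> by simp
    have D: "4 * real \<kappa> / real M \<le> D" using norm_one_minus_ee_ge[of k M] k \<kappa> by (simp add: D_def)
    have D0: "D > 0" using D \<kappa>0 M0 by (smt (verit) divide_pos_pos of_nat_0_less_iff)
    have "norm (saw_coeff M k) = 1 / (real M * D)"
      by (simp add: saw_coeff_def norm_divide norm_mult D_def)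
    also have "\<dots> \<le> 1 / (4 * real \<kappa>)"
      using D D0 \<kappa>0 M0 by (intro divide_left_mono) (auto simp: field_simps)
    finally have c: "norm (saw_coeff M k) \<le> 1 / (4 * real \<kappa>)" .
    have "norm (\<Sum>t<d. ee (- real k / real M) ^ t) \<le> (\<Sum>t<d. 1)"
      by (rule sum_norm_le) (simp add: norm_power)
    hence w1: "norm (w k) \<le> 1" using d by (simp add: w_def norm_divide)
    have ne: "ee (- real k / real M) \<noteq> 1" using D0 by (auto simp: D_def)
    have "norm (\<Sum>t<d. ee (- real k / real M) ^ t) = norm (ee (- real k / real M) ^ d - 1) / D"
      unfolding geometric_sum[OF ne] norm_divide D_def by (simp only: norm_minus_commute)
    also have "\<dots> \<le> 2 / D"
      using norm_triangle_ineq4[of "ee (- real k / real M) ^ d" 1] D0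
      by (intro divide_right_mono) (auto simp: norm_power)
    finally have "norm (w k) \<le> 2 / D / real d"
      using d unfolding w_def norm_divide norm_of_nat by (intro divide_right_mono) auto
    also have "\<dots> \<le> 2 / (4 * real \<kappa> / real M) / real d"
      using D D0 \<kappa>0 M0 by (intro divide_right_mono divide_left_mono) auto
    also have "\<dots> = real K / (2 * real \<kappa>)" using d MK by simp
    also have "\<dots> \<le> real K / real \<kappa>" using \<kappa>0 by (intro divide_left_mono) auto
    finally have "norm (w k) \<le> min 1 (real K / real \<kappa>)" using w1 by simp
    hence "norm (saw_coeff M k) * norm (w k) \<le> 1 / (4 * real \<kappa>) * min 1 (real K / real \<kappa>)"
      using c by (intro mult_mono) auto
    thus ?thesis by (simp add: norm_mult)
  qed
  have S_sym: "norm (S (M - k)) = norm (S k)" if "k < M" for k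
  proof -
    have "ee (real (M - k) * of_int (a n) / real M) = cnj (ee (real k * of_int (a n) / real M))" for n
    proof -
      have "real (M - k) * of_int (a n) / real M = of_int (a n) + - (real k * of_int (a n) / real M)"
        using that M0 by (simp add: of_nat_diff field_simps)
      thus ?thesis by (simp only: ee_add cnj_ee ee_of_int mult_1)
    qed
    hence "S (M - k) = cnj (S k)" by (simp add: S_def)
    thus ?thesis by simp
  qed
  have term_le: "norm (saw_coeff M k * w k * S k) \<le> b k + b (M - k)" if k: "k \<in> {1..<M}" for k
  proof -
    define \<kappa> where "\<kappa> = min k (M - k)"
    have \<kappa>: "1 \<le> \<kappa>" "\<kappa> < M" using k by (auto simp: \<kappa>_def)
    have H0: "0 \<le> H i" if "1 \<le> i" "i < M" for i using H[OF that] norm_ge_zero order_trans by blast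
    have b0: "0 \<le> b i" if "1 \<le> i" "i < M" for i using H0[OF that] by (simp add: b_def)
    have "norm (S k) = norm (S \<kappa>)" using S_sym[of k] k by (auto simp: \<kappa>_def min_def)
    also have "\<dots> \<le> H \<kappa>" using H[OF \<kappa>] by (simp add: S_def)
    finally have "norm (saw_coeff M k * w k) * norm (S k) \<le> min 1 (real K / real \<kappa>) / (4 * real \<kappa>) * H \<kappa>"
      using nc[OF _ _ \<kappa>_def] k by (intro mult_mono) auto
    hence "norm (saw_coeff M k * w k * S k) \<le> b \<kappa>" by (simp add: norm_mult b_def field_simps)
    also have "b \<kappa> \<le> b k + b (M - k)" using b0[of k] b0[of "M - k"] k by (auto simp: \<kappa>_def min_def)
    finally show ?thesis .
  qed
  define T where "T = (\<Sum>k=1..<M. saw_coeff M k * w k * S k)"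
  have "complex_of_real (\<Sum>n<N. (\<Sum>t<d. sawtooth M (a n - int t)) / real d)
     = of_nat N * of_real mean + (\<Sum>n<N. \<Sum>k=1..<M. saw_coeff M k * w k * ee (real k * of_int (a n) / real M))"
    by (simp only: of_real_sum avg sum.distrib sum_constant card_lessThan)
  also have "(\<Sum>n<N. \<Sum>k=1..<M. saw_coeff M k * w k * ee (real k * of_int (a n) / real M))
     = (\<Sum>k=1..<M. \<Sum>n<N. saw_coeff M k * w k * ee (real k * of_int (a n) / real M))"
    by (rule sum.swap)
  also have "\<dots> = T" by (simp add: T_def S_def sum_distrib_left)
  finally have "(\<Sum>n<N. (\<Sum>t<d. sawtooth M (a n - int t)) / real d) = Re (of_nat N * of_real mean + T)"
    by (metis Re_complex_of_real)
  hence eq: "(\<Sum>n<N. (\<Sum>t<d. sawtooth M (a n - int t)) / real d) = real N * mean + Re T" by simp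
  have "Re T \<le> norm T" by (rule complex_Re_le_cmod)
  also have "norm T \<le> (\<Sum>k=1..<M. b k + b (M - k))" unfolding T_def by (rule sum_norm_le) (rule term_le)
  also have "\<dots> = (\<Sum>k=1..<M. b k) + (\<Sum>k=1..<M. b (M - k))" by (rule sum.distrib)
  also have "(\<Sum>k=1..<M. b (M - k)) = (\<Sum>k=1..<M. b k)"
    by (subst (2) sum.atLeastLessThan_rev) simp
  also have "(\<Sum>k=1..<M. b k) + (\<Sum>k=1..<M. b k) = (\<Sum>k=1..<M. min 1 (real K / real k) / real k * H k) / 2"
  proof -
    have "(\<Sum>k=1..<M. b k) = (\<Sum>k=1..<M. min 1 (real K / real k) / real k * H k) / 4"
      by (simp only: b_def sum_divide_distrib)
    thus ?thesis by simp
  qed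
  finally have "Re T \<le> (\<Sum>k=1..<M. min 1 (real K / real k) / real k * H k) / 2" .
  moreover have "(\<Sum>n<N. sawtooth M (a n)) \<le> (\<Sum>n<N. (\<Sum>t<d. sawtooth M (a n - int t)) / real d + 1 / real K)"
    by (rule sum_mono) (rule pointwise)
  ultimately show ?thesis by (simp add: sum.distrib eq mean_def)
qed

text \<open>
  The terms up to \<open>K\<close> sum to at most \<open>2 sqrt K\<close>, and the tail of \<open>K / k powr (3/2)\<close> adds at most as much
  again. The induction carries the sharper bound \<open>4 sqrt K - 2 K / sqrt n\<close> beyond \<open>K\<close>.
\<close>

lemma sum_min_over_sqrt_le:
  assumes "K > 0"
  shows "(\<Sum>k=1..<M. min 1 (real K / real k) / sqrt (real k)) \<le> 4 * sqrt (real K)"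
proof -
  have "(\<Sum>k=1..n. min 1 (real K / real k) / sqrt (real k))
     \<le> (if n \<le> K then 2 * sqrt (real n) else 4 * sqrt (real K) - 2 * real K / sqrt (real n))" for n
  proof (induction n)
    case (Suc n)
    define p q where "p = sqrt (real n)" and "q = sqrt (real (Suc n))"
    have pq: "p \<ge> 0" "q > 0" "q * q = p * p + 1" "p \<le> q" by (auto simp: p_def q_def)
    have sum_Suc: "(\<Sum>k=1..Suc n. min 1 (real K / real k) / sqrt (real k))
      = (\<Sum>k=1..n. min 1 (real K / real k) / sqrt (real k)) + min 1 (real K / real (Suc n)) / q"
      by (simp add: q_def)
    show ?case
    proof (cases "Suc n \<le> K")
      case True
      have "0 \<le> (q - p) * (q - p)" by simp
      hence "1 \<le> (2 * q - 2 * p) * q" using pq(3) by (simp add: algebra_simps)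
      hence "1 / q \<le> 2 * q - 2 * p" using pq(2) by (simp add: pos_divide_le_eq)
      moreover have "min 1 (real K / real (Suc n)) / q \<le> 1 / q"
        using pq(2) by (intro divide_right_mono) auto
      ultimately show ?thesis using Suc True sum_Suc by (simp add: p_def q_def)
    next
      case False
      hence p0: "p > 0" using assms by (simp add: p_def)
      have "p * (p + q) \<le> q * (q + q)" using pq by (intro mult_mono) auto
      hence "p * (p + q) \<le> (q * q) * 2" by (simp add: algebra_simps)
      have qp: "(q - p) * (q + p) = 1" using pq(3) by (simp add: algebra_simps)
      have "p * q * (p + q) * 1 \<le> 2 * q * (q * q)"
        using mult_right_mono[OF \<open>p * (p + q) \<le> (q * q) * 2\<close>, of q] pq by (simp add: mult_ac)
      hence "p * q * (p + q) * 1 \<le> p * q * (p + q) * (2 * (q - p) * q * q / p)"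
      proof -
        have "p * q * (p + q) * (2 * (q - p) * q * q / p) = 2 * q * (q * q) * ((q - p) * (q + p))"
          using p0 by (simp add: field_simps)
        thus ?thesis using qp \<open>p * q * (p + q) * 1 \<le> 2 * q * (q * q)\<close> by simp
      qed
      hence "1 \<le> 2 * (q - p) * q * q / p"
        using p0 pq(2) by (subst (asm) mult_le_cancel_left_pos) auto
      hence "1 / (q * q * q) \<le> 2 / p - 2 / q" using p0 pq(2) by (simp add: field_simps)
      hence "real K * (1 / (q * q * q)) \<le> real K * (2 / p - 2 / q)" by (intro mult_left_mono) auto
      moreover have "min 1 (real K / real (Suc n)) / q \<le> real K * (1 / (q * q * q))"
      proof -
        have "real (Suc n) = q * q" by (simp add: q_def)
        hence "real K * (1 / (q * q * q)) = real K / real (Suc n) / q" by (simp only:) simp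
        moreover have "min 1 (real K / real (Suc n)) / q \<le> real K / real (Suc n) / q"
          using pq(2) by (intro divide_right_mono) auto
        ultimately show ?thesis by (simp only:)
      qed
      moreover have "(\<Sum>k=1..n. min 1 (real K / real k) / sqrt (real k)) \<le> 4 * sqrt (real K) - 2 * real K / p"
      proof (cases "n = K")
        case True
        have "real K / sqrt (real K) = sqrt (real K)" by (rule real_div_sqrt) simp
        thus ?thesis using Suc True by (simp add: p_def)
      next
        case False2: False
        thus ?thesis using Suc False by (simp add: p_def)
      qed
      ultimately have "(\<Sum>k=1..Suc n. min 1 (real K / real k) / sqrt (real k))
          \<le> 4 * sqrt (real K) - 2 * real K / q"
        unfolding sum_Suc by (simp only: right_diff_distrib times_divide_eq_right mult.commute[of _ 2])
      thus ?thesis using False by (simp only: q_def if_False)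
    qed
  qed simp
  from this[of "M - 1"] have "(\<Sum>k=1..M-1. min 1 (real K / real k) / sqrt (real k)) \<le> 4 * sqrt (real K)"
    using assms by (smt (verit) divide_nonneg_nonneg of_nat_0_le_iff real_sqrt_ge_zero real_sqrt_le_mono of_nat_mono)
  moreover have "{1..<M} = {1..M-1}" by auto
  ultimately show ?thesis by simp
qed

section \<open>Fractional parts of sequences with small second differences\<close>

lemma sawtooth_uminus:
  assumes "M > 0"
  shows "sawtooth M (- a - 1) = (real M - 1) / real M - sawtooth M a"
proof -
  define q r where "q = a div int M" and "r = a mod int M"
  have a: "a = q * int M + r" "0 \<le> r" "r < int M" using assms by (auto simp: q_def r_def)
  have "- a - 1 = (- q - 1) * int M + (int M - 1 - r)"
    unfolding a(1) by (simp add: algebra_simps)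
  hence "(- a - 1) mod int M = ((- q - 1) * int M + (int M - 1 - r)) mod int M" by (simp only:)
  also have "\<dots> = (int M - 1 - r) mod int M" by (rule mod_mult_self3)
  also have "\<dots> = int M - 1 - r" using a(2,3) by (intro mod_pos_pos_trivial) auto
  finally have "(- a - 1) mod int M = int M - 1 - a mod int M" by (simp only: r_def)
  thus ?thesis using assms by (simp add: sawtooth_def diff_divide_distrib)
qed

lemma frac_minus_sawtooth:
  assumes "M > 0"
  shows "0 \<le> frac x - sawtooth M \<lfloor>real M * x\<rfloor>" "frac x - sawtooth M \<lfloor>real M * x\<rfloor> \<le> 1 / real M"
proof -
  have "\<lfloor>real M * x\<rfloor> div int M = \<lfloor>real M * x / real_of_int (int M)\<rfloor>"
    by (rule floor_divide_real_eq_div[symmetric]) simp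
  hence "\<lfloor>real M * x\<rfloor> div int M = \<lfloor>x\<rfloor>" using assms by simp
  hence "\<lfloor>real M * x\<rfloor> mod int M = \<lfloor>real M * x\<rfloor> - int M * \<lfloor>x\<rfloor>"
    by (metis minus_mult_div_eq_mod)
  hence "frac x - sawtooth M \<lfloor>real M * x\<rfloor> = (real M * x - of_int \<lfloor>real M * x\<rfloor>) / real M"
    using assms by (simp add: sawtooth_def frac_def diff_divide_distrib)
  moreover have "0 \<le> real M * x - of_int \<lfloor>real M * x\<rfloor>" "real M * x - of_int \<lfloor>real M * x\<rfloor> \<le> 1"
    by linarith+
  ultimately show "0 \<le> frac x - sawtooth M \<lfloor>real M * x\<rfloor>" "frac x - sawtooth M \<lfloor>real M * x\<rfloor> \<le> 1 / real M"
    by (auto intro: divide_right_mono)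
qed

text \<open>
  Rounding \<open>x n\<close> down to a multiple of \<open>1/M\<close> perturbs second differences by at most \<open>2/M\<close>, which is at
  most half of \<open>\<theta>\<close>. The rounded sequence therefore still satisfies the hypotheses of the second
  difference test, after the change of sign that makes it convex.
\<close>

lemma discretized_exponential_sum:
  fixes x :: "nat \<Rightarrow> real"
  assumes lam: "0 < \<theta>" and h: "1 \<le> h" and M: "4 / \<theta> \<le> real M" and k: "1 \<le> k"
    and sd: "\<And>n. n + 2 \<le> N \<Longrightarrow> \<theta> \<le> 2 * x (n + 1) - x n - x (n + 2)"
            "\<And>n. n + 2 \<le> N \<Longrightarrow> 2 * x (n + 1) - x n - x (n + 2) \<le> h * \<theta>"
  shows "norm (\<Sum>n<N. ee (real k * of_int \<lfloor>real M * x n\<rfloor> / real M))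
    \<le> 12 * h * real N * sqrt \<theta> * sqrt (real k) + 12 / (sqrt \<theta> * sqrt (real k))"
proof -
  define a where "a n = \<lfloor>real M * x n\<rfloor>" for n
  define \<mu> where "\<mu> = real k * \<theta> / 2"
  have M0: "real M > 0" using M lam by (smt (verit) divide_pos_pos)
  have mu: "\<mu> > 0" using lam k by (simp add: \<mu>_def)
  define y where "y n = - (real k * of_int (a n) / real M)" for n
  have "norm (\<Sum>n<N. ee (y n)) \<le> 4 * (2 * h + 1) * real N * sqrt \<mu> + 8 / sqrt \<mu>"
  proof (rule second_difference_test)
    fix n assume n: "n + 2 \<le> N"
    define D where "D = 2 * x (n + 1) - x n - x (n + 2)"
    define E where "E = 2 * of_int (a (n + 1)) - of_int (a n) - (of_int (a (n + 2)) :: real)"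
    have "of_int (a i) \<le> real M * x i \<and> real M * x i < of_int (a i) + 1" for i
      unfolding a_def by linarith
    from this[of n] this[of "n+1"] this[of "n+2"]
    have E: "real M * D - 2 \<le> E" "E \<le> real M * D + 2"
      unfolding D_def E_def by (simp_all add: algebra_simps)
    have y: "y (n + 2) - 2 * y (n + 1) + y n = real k * (E / real M)"
      by (simp add: y_def E_def algebra_simps diff_divide_distrib add_divide_distrib)
    have D: "\<theta> \<le> D" "D \<le> h * \<theta>" using sd[OF n] by (auto simp: D_def)
    have "2 / real M \<le> \<theta> / 2" using M M0 lam by (simp add: field_simps)
    moreover have "D - 2 / real M \<le> E / real M" "E / real M \<le> D + 2 / real M"
      using divide_right_mono[OF E(1), of "real M"] divide_right_mono[OF E(2), of "real M"] M0
      by (simp_all add: diff_divide_distrib add_divide_distrib)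
    ultimately have "\<theta> / 2 \<le> E / real M" "E / real M \<le> h * \<theta> + \<theta> / 2" using D by linarith+
    hence "real k * (\<theta> / 2) \<le> real k * (E / real M)"
      and "real k * (E / real M) \<le> real k * (h * \<theta> + \<theta> / 2)"
      by (blast intro: mult_left_mono of_nat_0_le_iff)+
    thus "\<mu> \<le> y (n + 2) - 2 * y (n + 1) + y n"
      "y (n + 2) - 2 * y (n + 1) + y n \<le> (2 * h + 1) * \<mu>"
      unfolding y by (simp_all add: \<mu>_def algebra_simps add_divide_distrib)
  qed (use mu h in auto)
  moreover have "norm (\<Sum>n<N. ee (y n)) = norm (\<Sum>n<N. ee (real k * of_int (a n) / real M))"
  proof -
    have "(\<Sum>n<N. ee (y n)) = cnj (\<Sum>n<N. ee (real k * of_int (a n) / real M))"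
      by (simp add: y_def cnj_ee)
    thus ?thesis by (simp only: complex_mod_cnj)
  qed
  moreover have "4 * (2 * h + 1) * real N * sqrt \<mu> \<le> 4 * (3 * h) * real N * (sqrt \<theta> * sqrt (real k))"
    using h lam unfolding real_sqrt_mult[symmetric]
    by (intro mult_mono) (auto simp: \<mu>_def)
  moreover have "8 / sqrt \<mu> \<le> 12 / (sqrt \<theta> * sqrt (real k))"
  proof -
    have "sqrt (real k * \<theta>) \<le> sqrt ((9 / 4) * \<mu>)" using lam by (simp add: \<mu>_def)
    also have "\<dots> = 3 / 2 * sqrt \<mu>" by (simp add: real_sqrt_mult real_sqrt_divide)
    finally have "sqrt \<theta> * sqrt (real k) \<le> 3 / 2 * sqrt \<mu>"
      by (simp add: real_sqrt_mult mult.commute)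
    moreover have "0 < sqrt \<theta> * sqrt (real k)" "0 < sqrt \<mu>" using lam k mu by auto
    ultimately show ?thesis by (simp add: divide_simps)
  qed
  ultimately show ?thesis by (simp add: a_def mult_ac)
qed

text \<open>
  Van der Corput's estimate: the fractional parts of a sequence whose second differences have the
  constant order of magnitude \<open>\<theta>\<close> average to \<open>1/2\<close>. The smoothing error \<open>N/K\<close> and the contribution
  \<open>N sqrt (\<theta> K)\<close> of the exponential sums are balanced by \<open>K = \<theta> powr (-1/3)\<close>. The modulus \<open>M\<close> only has to
  be large compared with \<open>1/\<theta>\<close>; taking it as a multiple of \<open>K\<close> makes the averaging length \<open>d = M/K\<close> an
  integer.
\<close>

lemma sum_frac_second_difference:
  fixes x :: "nat \<Rightarrow> real"
  assumes lam: "0 < \<theta>" "\<theta> \<le> 1" and h: "1 \<le> h"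
    and sd: "\<And>n. n + 2 \<le> N \<Longrightarrow> \<theta> \<le> 2 * x (n + 1) - x n - x (n + 2)"
            "\<And>n. n + 2 \<le> N \<Longrightarrow> 2 * x (n + 1) - x n - x (n + 2) \<le> h * \<theta>"
  shows "\<bar>\<Sum>n<N. (frac (x n) - 1 / 2)\<bar> \<le> 60 * h * (real N * \<theta> powr (1/3) + \<theta> powr (-1/2))"
proof -
  define K where "K = nat \<lceil>\<theta> powr (-1/3)\<rceil>"
  define d where "d = nat \<lceil>4 / \<theta>\<rceil>"
  define M where "M = K * d"
  have lp: "\<theta> powr (-1/3) \<ge> 1" using lam by (simp add: powr_minus_divide le_divide_eq_1 powr_le1)
  have K: "\<theta> powr (-1/3) \<le> real K" "real K \<le> 2 * \<theta> powr (-1/3)"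
    using lp unfolding K_def by linarith+
  have d: "4 / \<theta> \<le> real d" unfolding d_def by linarith
  have K0: "K > 0" using K lp by (cases K) auto
  have d0: "d > 0" using d lam by (metis divide_pos_pos gr0I leD of_nat_0 zero_less_numeral)
  have M0: "M > 0" using K0 d0 by (simp add: M_def)
  have Kle: "K \<le> M" using d0 by (simp add: M_def)
  have "d \<le> M" using K0 by (simp add: M_def)
  hence dM: "4 / \<theta> \<le> real M" using d by linarith
  define a where "a n = \<lfloor>real M * x n\<rfloor>" for n
  define A B where "A = 12 * h * real N * sqrt \<theta>" and "B = 12 / sqrt \<theta>"
  define H where "H k = A * sqrt (real k) + B / sqrt (real k)" for k
  define mean where "mean = (real M - 1) / (2 * real M)"
  have A0: "A \<ge> 0" and B0: "B \<ge> 0" using h lam by (auto simp: A_def B_def)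
  have S: "norm (\<Sum>n<N. ee (real k * of_int (a n) / real M)) \<le> H k" if "1 \<le> k" for k
    using discretized_exponential_sum[OF lam(1) h dM that sd] by (simp add: H_def A_def B_def a_def)
  have S': "norm (\<Sum>n<N. ee (real k * of_int (- a n - 1) / real M)) \<le> H k" if "1 \<le> k" for k
  proof -
    have "ee (real k * of_int (- a n - 1) / real M) = ee (- real k / real M) * cnj (ee (real k * of_int (a n) / real M))" for n
    proof -
      have "real k * of_int (- a n - 1) / real M = - real k / real M + - (real k * of_int (a n) / real M)"
        by (simp add: right_diff_distrib diff_divide_distrib)
      thus ?thesis by (simp only: ee_add cnj_ee)
    qed
    hence "(\<Sum>n<N. ee (real k * of_int (- a n - 1) / real M))
        = ee (- real k / real M) * cnj (\<Sum>n<N. ee (real k * of_int (a n) / real M))"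
      by (simp add: sum_distrib_left)
    hence "norm (\<Sum>n<N. ee (real k * of_int (- a n - 1) / real M)) = norm (\<Sum>n<N. ee (real k * of_int (a n) / real M))"
      by (simp only: norm_mult norm_ee complex_mod_cnj mult_1)
    thus ?thesis using S[OF that] by simp
  qed
  define Q where "Q = (\<Sum>k=1..<M. min 1 (real K / real k) / real k * H k) / 2"
  have up: "(\<Sum>n<N. sawtooth M (a n)) - real N * mean \<le> real N / real K + Q"
    unfolding Q_def mean_def by (rule finite_erdos_turan[OF M_def K0 d0]) (rule S)
  have "(\<Sum>n<N. sawtooth M (- a n - 1)) - real N * mean \<le> real N / real K + Q"
    unfolding Q_def mean_def by (rule finite_erdos_turan[OF M_def K0 d0]) (rule S')
  moreover have "(\<Sum>n<N. sawtooth M (- a n - 1)) = real N * (2 * mean) - (\<Sum>n<N. sawtooth M (a n))"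
  proof -
    have "2 * mean = (real M - 1) / real M" using M0 by (simp add: mean_def field_simps)
    thus ?thesis by (simp only: sawtooth_uminus[OF M0] sum_subtractf sum_constant card_lessThan)
  qed
  ultimately have lo: "real N * mean - (\<Sum>n<N. sawtooth M (a n)) \<le> real N / real K + Q"
    by (simp add: algebra_simps)
  have Q: "Q \<le> 2 * A * sqrt (real K) + 2 * B"
  proof -
    have "(\<Sum>k=1..<M. min 1 (real K / real k) / real k * H k)
       \<le> (\<Sum>k=1..<M. A * (min 1 (real K / real k) / sqrt (real k)) + B * (min 1 (real 1 / real k) / sqrt (real k)))"
    proof (rule sum_mono)
      fix k assume "k \<in> {1..<M}"
      hence k: "real k \<ge> 1" by simp
      define p where "p = sqrt (real k)"
      have p: "real k = p * p" "p > 0" using k by (auto simp: p_def)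
      define m where "m = min 1 (real K / real k)"
      have m: "m \<le> 1" by (simp add: m_def)
      have "m / real k * H k = A * (m / p) + B * (m / (p * p * p))"
        using p by (simp add: H_def p_def[symmetric] field_simps)
      also have "B * (m / (p * p * p)) \<le> B * (1 / (p * p * p))"
        using m p B0 by (intro mult_left_mono divide_right_mono) auto
      also have "1 / (p * p * p) = min 1 (real 1 / real k) / p"
        using k p by (simp add: min_def)
      finally show "min 1 (real K / real k) / real k * H k
        \<le> A * (min 1 (real K / real k) / sqrt (real k)) + B * (min 1 (real 1 / real k) / sqrt (real k))"
        by (simp add: m_def p_def)
    qed
    also have "\<dots> = A * (\<Sum>k=1..<M. min 1 (real K / real k) / sqrt (real k))
        + B * (\<Sum>k=1..<M. min 1 (real 1 / real k) / sqrt (real k))"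
      by (simp only: sum.distrib sum_distrib_left)
    also have "\<dots> \<le> A * (4 * sqrt (real K)) + B * (4 * sqrt (real 1))"
      using A0 B0 K0 by (intro add_mono mult_left_mono sum_min_over_sqrt_le) auto
    finally show ?thesis by (simp add: Q_def)
  qed
  have sqrtK: "sqrt \<theta> * sqrt (real K) \<le> 3 / 2 * \<theta> powr (1/3)"
  proof -
    have "sqrt (real K) \<le> sqrt (9 / 4 * \<theta> powr (-1/3))" using K by simp
    also have "\<dots> = 3 / 2 * \<theta> powr (-1/6)"
      using lam by (simp add: real_sqrt_mult real_sqrt_divide powr_half_sqrt[symmetric] powr_powr)
    finally have "sqrt \<theta> * sqrt (real K) \<le> sqrt \<theta> * (3 / 2 * \<theta> powr (-1/6))"
      using lam by (intro mult_left_mono) auto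
    also have "\<dots> = 3 / 2 * (\<theta> powr (1/2) * \<theta> powr (-1/6))" using lam by (simp add: powr_half_sqrt)
    also have "\<theta> powr (1/2) * \<theta> powr (-1/6) = \<theta> powr (1/3)" by (simp flip: powr_add)
    finally show ?thesis .
  qed
  have "2 * A * sqrt (real K) = 24 * h * real N * (sqrt \<theta> * sqrt (real K))" by (simp add: A_def)
  also have "\<dots> \<le> 24 * h * real N * (3 / 2 * \<theta> powr (1/3))" using sqrtK h by (intro mult_left_mono) auto
  finally have 1: "2 * A * sqrt (real K) \<le> 36 * (h * (real N * \<theta> powr (1/3)))" by simp
  have "2 * B = 24 * \<theta> powr (-1/2)"
    using lam by (simp add: B_def powr_minus_divide powr_half_sqrt)
  also have "\<dots> \<le> 24 * (h * \<theta> powr (-1/2))" using h mult_right_mono[OF h, of "\<theta> powr (-1/2)"] by simp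
  finally have 2: "2 * B \<le> 24 * (h * \<theta> powr (-1/2))" .
  have "real N / real K \<le> real N / \<theta> powr (-1/3)"
    using K lam K0 by (intro divide_left_mono mult_pos_pos) auto
  also have "\<dots> = real N * \<theta> powr (1/3)" using lam by (simp add: powr_minus_divide)
  finally have 3: "real N / real K \<le> real N * \<theta> powr (1/3)" .
  have "real N * \<theta> powr (1/3) \<le> h * (real N * \<theta> powr (1/3))"
    using mult_right_mono[OF h, of "real N * \<theta> powr (1/3)"] by simp
  with 3 have 3: "real N / real K \<le> h * (real N * \<theta> powr (1/3))" by linarith
  have 4: "real N / real M \<le> real N / real K"
    using Kle K0 by (intro divide_left_mono) auto
  have "0 \<le> (\<Sum>n<N. frac (x n) - sawtooth M (a n))"
    unfolding a_def by (intro sum_nonneg frac_minus_sawtooth[OF M0])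
  hence 5: "(\<Sum>n<N. sawtooth M (a n)) \<le> (\<Sum>n<N. frac (x n))" by (simp add: sum_subtractf)
  have "(\<Sum>n<N. frac (x n) - sawtooth M (a n)) \<le> (\<Sum>n<N. 1 / real M)"
    unfolding a_def by (intro sum_mono frac_minus_sawtooth[OF M0])
  hence 6: "(\<Sum>n<N. frac (x n)) \<le> (\<Sum>n<N. sawtooth M (a n)) + real N / real M" by (simp add: sum_subtractf)
  define u where "u = real N / real M"
  have 7: "real N * mean = real N / 2 - u / 2"
    using M0 by (simp add: mean_def u_def field_simps)
  have 8: "0 \<le> u" by (simp add: u_def)
  have "(\<Sum>n<N. (frac (x n) - 1 / 2)) = (\<Sum>n<N. frac (x n)) - real N / 2"
    by (simp add: sum_subtractf)
  moreover have "60 * h * (real N * \<theta> powr (1/3) + \<theta> powr (-1/2))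
    = 60 * (h * (real N * \<theta> powr (1/3))) + 60 * (h * \<theta> powr (-1/2))" by (simp add: algebra_simps)
  moreover have "0 \<le> h * \<theta> powr (-1/2)" "0 \<le> h * (real N * \<theta> powr (1/3))" using h by auto
  ultimately show ?thesis using up lo Q 1 2 3 4 5 6 8 unfolding u_def[symmetric] 7 abs_le_iff by linarith
qed

section \<open>Decreasing concave curves and the area they enclose\<close>

text \<open>
  Fubini in either order of integration; the second pair of statements is used for regions described
  by \<open>x \<le> g y\<close>. Clamping the argument of \<open>F\<close> makes it continuous on the whole line, so that the region
  is visibly closed.
\<close>

lemma region_under_graph:
  fixes F :: "real \<Rightarrow> real"
  assumes a: "0 \<le> a" and cont: "continuous_on {0..a} F" and nonneg: "\<And>x. x \<in> {0..a} \<Longrightarrow> 0 \<le> F x"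
  shows "closed {(x, y). 0 \<le> x \<and> x \<le> a \<and> 0 \<le> y \<and> y \<le> F x}" (is "closed ?R")
    and "emeasure lborel {(x, y). 0 \<le> x \<and> x \<le> a \<and> 0 \<le> y \<and> y \<le> F x} = ennreal (integral {0..a} F)"
    and "closed {(y, x). 0 \<le> x \<and> x \<le> a \<and> 0 \<le> y \<and> y \<le> F x}" (is "closed ?R'")
    and "emeasure lborel {(y, x). 0 \<le> x \<and> x \<le> a \<and> 0 \<le> y \<and> y \<le> F x} = ennreal (integral {0..a} F)"
proof -
  define F' where "F' x = F (max 0 (min a x))" for x
  have F'_eq: "F' x = F x" if "0 \<le> x" "x \<le> a" for x using that by (simp add: F'_def)
  have F'_cont: "continuous_on UNIV F'"
    unfolding F'_def by (rule continuous_on_compose2[OF cont]) (use a in \<open>auto intro!: continuous_intros\<close>)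
  have cl: "closed {p :: real \<times> real. 0 \<le> fst p \<and> fst p \<le> a \<and> 0 \<le> snd p \<and> snd p \<le> F' (fst p)}"
    by (intro closed_Collect_conj closed_Collect_le continuous_intros continuous_on_compose2[OF F'_cont]) auto
  have cl': "closed {p :: real \<times> real. 0 \<le> snd p \<and> snd p \<le> a \<and> 0 \<le> fst p \<and> fst p \<le> F' (snd p)}"
    by (intro closed_Collect_conj closed_Collect_le continuous_intros continuous_on_compose2[OF F'_cont]) auto
  have R: "?R = {p. 0 \<le> fst p \<and> fst p \<le> a \<and> 0 \<le> snd p \<and> snd p \<le> F' (fst p)}" by (auto simp: F'_eq)
  have R': "?R' = {p. 0 \<le> snd p \<and> snd p \<le> a \<and> 0 \<le> fst p \<and> fst p \<le> F' (snd p)}" by (auto simp: F'_eq)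
  show closed: "closed ?R" unfolding R by (rule cl)
  show closed': "closed ?R'" unfolding R' by (rule cl')
  have "(F has_integral integral {0..a} F) {0..a}"
    using cont by (intro integrable_integral integrable_continuous_interval)
  hence int: "(\<integral>\<^sup>+x. ennreal (indicator {0..a} x * F x) \<partial>lborel) = ennreal (integral {0..a} F)"
    by (intro nn_integral_has_integral_lebesgue nonneg)
  have slice: "emeasure lborel {y. 0 \<le> x \<and> x \<le> a \<and> 0 \<le> y \<and> y \<le> F x} = ennreal (indicator {0..a} x * F x)" for x
  proof (cases "x \<in> {0..a}")
    case True
    hence "{y. 0 \<le> x \<and> x \<le> a \<and> 0 \<le> y \<and> y \<le> F x} = {0..F x}" by auto
    thus ?thesis using True nonneg[OF True] by simp
  next
    case False
    hence "{y. 0 \<le> x \<and> x \<le> a \<and> 0 \<le> y \<and> y \<le> F x} = {}" by auto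
    thus ?thesis using False by (simp only: emeasure_empty) simp
  qed
  have sets: "?R \<in> sets (lborel \<Otimes>\<^sub>M lborel)" "?R' \<in> sets (lborel \<Otimes>\<^sub>M lborel)"
    using closed closed' by (simp_all only: lborel_prod sets_lborel borel_closed)
  have "emeasure (lborel \<Otimes>\<^sub>M lborel) ?R = (\<integral>\<^sup>+x. emeasure lborel (Pair x -` ?R) \<partial>lborel)"
    by (rule lborel.emeasure_pair_measure_alt[OF sets(1)])
  also have "\<dots> = ennreal (integral {0..a} F)"
    unfolding int[symmetric] slice[symmetric] by (intro nn_integral_cong arg_cong[where f = "emeasure lborel"]) auto
  finally show "emeasure lborel ?R = ennreal (integral {0..a} F)" by (simp add: lborel_prod)
  have "emeasure (lborel \<Otimes>\<^sub>M lborel) ?R' = (\<integral>\<^sup>+x. emeasure lborel ((\<lambda>y. (y, x)) -` ?R') \<partial>lborel)"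
    by (rule lborel_pair.emeasure_pair_measure_alt2[OF sets(2)])
  also have "\<dots> = ennreal (integral {0..a} F)"
    unfolding int[symmetric] slice[symmetric] by (intro nn_integral_cong arg_cong[where f = "emeasure lborel"]) auto
  finally show "emeasure lborel ?R' = ennreal (integral {0..a} F)" by (simp add: lborel_prod)
qed

text \<open>
  The hypotheses on the curve that do not involve derivatives. They are symmetric under reflection
  in the diagonal, which exchanges \<open>f\<close> and \<open>g\<close> (lemma \<open>swap\<close>); so whatever is proved for the columns
  of lattice points under the curve also holds for its rows.
\<close>

locale decreasing_concave_curve =
  fixes L :: real and f g :: "real \<Rightarrow> real"
  assumes L_pos: "0 < L"
    and f_maps: "f \<in> {0..L} \<rightarrow> {0..L}" and g_maps: "g \<in> {0..L} \<rightarrow> {0..L}"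
    and f_cont: "continuous_on {0..L} f"
    and f_concave: "concave_on {0..L} f"
    and f_decreasing: "strict_antimono_on {0..L} f"
    and f_0: "f 0 = L" and f_L: "f L = 0"
    and g_f: "\<forall>x\<in>{0..L}. g (f x) = x" and f_g: "\<forall>y\<in>{0..L}. f (g y) = y"
begin

lemma f_in: "0 \<le> x \<Longrightarrow> x \<le> L \<Longrightarrow> 0 \<le> f x" "0 \<le> x \<Longrightarrow> x \<le> L \<Longrightarrow> f x \<le> L"
  using f_maps by (auto simp: Pi_iff)

lemma g_in: "0 \<le> y \<Longrightarrow> y \<le> L \<Longrightarrow> 0 \<le> g y" "0 \<le> y \<Longrightarrow> y \<le> L \<Longrightarrow> g y \<le> L"
  using g_maps by (auto simp: Pi_iff)

lemma f_less: "0 \<le> x \<Longrightarrow> x < y \<Longrightarrow> y \<le> L \<Longrightarrow> f y < f x"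
  using f_decreasing by (auto simp: monotone_on_def)

lemma f_le: "0 \<le> x \<Longrightarrow> x \<le> y \<Longrightarrow> y \<le> L \<Longrightarrow> f y \<le> f x"
  using f_less[of x y] by (cases "x = y") auto

lemma le_f_iff_le_g:
  assumes "0 \<le> x" "x \<le> L" "0 \<le> y" "y \<le> L"
  shows "y \<le> f x \<longleftrightarrow> x \<le> g y"
proof -
  have fg: "f (g y) = y" using f_g assms by simp
  show ?thesis
  proof
    assume "x \<le> g y"
    thus "y \<le> f x" using f_le[of x "g y"] g_in[of y] assms fg by simp
  next
    assume "y \<le> f x"
    thus "x \<le> g y" using f_less[of "g y" x] g_in[of y] assms fg by (cases "x \<le> g y") simp_all
  qed
qed

lemma swap: "decreasing_concave_curve L g f"
proof
  have img: "f ` {0..L} = {0..L}"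
  proof
    show "{0..L} \<subseteq> f ` {0..L}"
    proof
      fix y assume y: "y \<in> {0..L}"
      hence "g y \<in> {0..L}" "y = f (g y)" using g_maps f_g by auto
      thus "y \<in> f ` {0..L}" by blast
    qed
  qed (use f_maps in auto)
  show "continuous_on {0..L} g"
    using continuous_on_inv[OF f_cont compact_Icc] g_f img by simp
  show anti: "strict_antimono_on {0..L} g"
  proof (rule monotone_onI)
    fix x y assume xy: "x \<in> {0..L}" "y \<in> {0..L}" "x < y"
    have "f (g x) = x" "f (g y) = y" using f_g xy by auto
    with f_le[of "g x" "g y"] xy g_in[of x] g_in[of y] show "g y < g x"
      by (cases "g x \<le> g y") auto
  qed
  have comb: "(1 - t) * u + t * v \<in> {0..L}" if "0 < t" "t < 1" "u \<in> {0..L}" "v \<in> {0..L}" for t u v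
    using convexD[OF convex_real_interval(5)[of 0 L] that(3,4), of "1 - t" t] that by simp
  show "concave_on {0..L} g"
    unfolding concave_on_def
  proof (rule convex_onI)
    fix t x y assume t: "(0::real) < t" "t < 1" and xy: "x \<in> {0..L}" "y \<in> {0..L}"
    let ?z = "(1 - t) * g x + t * g y"
    have gxy: "g x \<in> {0..L}" "g y \<in> {0..L}" using xy g_in by auto
    have "f ?z \<ge> (1 - t) * f (g x) + t * f (g y)"
      using concave_onD[OF f_concave, of t "g x" "g y"] t gxy by simp
    hence "(1 - t) * x + t * y \<le> f ?z" using f_g xy by simp
    hence "?z \<le> g ((1 - t) * x + t * y)"
      using le_f_iff_le_g[of ?z "(1 - t) * x + t * y"] comb[OF t gxy] comb[OF t xy] by auto
    thus "- g ((1 - t) *\<^sub>R x + t *\<^sub>R y) \<le> (1 - t) * - g x + t * - g y" by simp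
  qed simp
  have "g (f L) = L" "g (f 0) = 0" using g_f L_pos by auto
  thus "g 0 = L" "g L = 0" using f_0 f_L by auto
qed (use L_pos f_maps g_maps g_f f_g in auto)

text \<open>
  The region under the curve is the union of its part left of \<open>x = a\<close> and its part below \<open>y = f a\<close>;
  the two overlap in a rectangle.
\<close>

lemma area_split:
  assumes a: "0 \<le> a" "a \<le> L"
  shows "Area L f = integral {0..a} f + integral {0..f a} g - a * f a"
proof -
  interpret g: decreasing_concave_curve L g f by (rule swap)
  define A B where "A = {(x, y). 0 \<le> x \<and> x \<le> a \<and> 0 \<le> y \<and> y \<le> f x}"
    and "B = {(x, y). 0 \<le> y \<and> y \<le> f a \<and> 0 \<le> x \<and> x \<le> g y}"
  have fa: "0 \<le> f a" "f a \<le> L" using f_in a by auto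
  have ca: "continuous_on {0..a} f" "continuous_on {0..f a} g"
    using f_cont g.f_cont a fa by (auto elim: continuous_on_subset)
  have nonneg: "\<And>x. x \<in> {0..a} \<Longrightarrow> 0 \<le> f x" "\<And>x. x \<in> {0..f a} \<Longrightarrow> 0 \<le> g x"
    using f_in(1) a g_in(1) order_trans[OF _ fa(2)] by auto
  have A: "closed A" "emeasure lborel A = ennreal (integral {0..a} f)"
    unfolding A_def using region_under_graph(1,2)[OF a(1) ca(1) nonneg(1)] by auto
  have B: "closed B" "emeasure lborel B = ennreal (integral {0..f a} g)"
    unfolding B_def using region_under_graph(3,4)[OF fa(1) ca(2) nonneg(2)] by auto
  have meas: "S \<in> lmeasurable \<and> measure lebesgue S = i"
    if "closed S" "emeasure lborel S = ennreal i" "0 \<le> i" for S :: "(real \<times> real) set" and i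
  proof -
    have e: "emeasure lebesgue S = ennreal i" using that by (simp add: emeasure_completion borel_closed)
    have "S \<in> sets lebesgue" using that(1) by (simp add: borel_closed)
    thus ?thesis using e that(3) by (simp add: fmeasurable_def measure_def)
  qed
  have mA: "A \<in> lmeasurable" "measure lebesgue A = integral {0..a} f"
    using meas[OF A] integral_nonneg[OF integrable_continuous_interval[OF ca(1)] nonneg(1)] by auto
  have mB: "B \<in> lmeasurable" "measure lebesgue B = integral {0..f a} g"
    using meas[OF B] integral_nonneg[OF integrable_continuous_interval[OF ca(2)] nonneg(2)] by auto
  have AB: "A \<inter> B = {0..a} \<times> {0..f a}"
  proof (intro equalityI subrelI)
    fix x y assume "(x, y) \<in> {0..a} \<times> {0..f a}"
    moreover from this have "y \<le> f x" using f_le[of x a] a by force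
    ultimately show "(x, y) \<in> A \<inter> B"
      using le_f_iff_le_g[of x y] a fa by (auto simp: A_def B_def)
  qed (auto simp: A_def B_def)
  have un: "{(x, y). 0 \<le> x \<and> x \<le> L \<and> 0 \<le> y \<and> y \<le> f x} = A \<union> B"
  proof (intro equalityI subrelI)
    fix x y assume *: "(x, y) \<in> {(x, y). 0 \<le> x \<and> x \<le> L \<and> 0 \<le> y \<and> y \<le> f x}"
    show "(x, y) \<in> A \<union> B"
    proof (cases "x \<le> a")
      case False
      hence "f x \<le> f a" using f_le[of a x] a * by auto
      with * show ?thesis using le_f_iff_le_g[of x y] fa by (auto simp: B_def)
    qed (use * in \<open>auto simp: A_def\<close>)
  next
    fix x y assume "(x, y) \<in> A \<union> B"
    moreover have "x \<le> L \<and> y \<le> f x" if "(x, y) \<in> B"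
    proof -
      have "g y \<le> L" using that g_in[of y] fa by (auto simp: B_def)
      hence "x \<le> L" using that by (auto simp: B_def)
      thus ?thesis using le_f_iff_le_g[of x y] that fa by (auto simp: B_def)
    qed
    ultimately show "(x, y) \<in> {(x, y). 0 \<le> x \<and> x \<le> L \<and> 0 \<le> y \<and> y \<le> f x}"
      using a by (auto simp: A_def B_def)
  qed
  have "measure lebesgue ({0..a} \<times> {0..f a}) = a * f a"
  proof -
    have "{0..a} \<times> {0..f a} = cbox (0, 0) (a, f a)" by (simp add: cbox_Pair_eq)
    hence "measure lebesgue ({0..a} \<times> {0..f a}) = measure lborel (cbox (0, 0) (a, f a))"
      by (simp add: measure_completion)
    thus ?thesis using a fa by (simp add: content_Pair)
  qed
  thus ?thesis
    unfolding Area_def un using measure_Un3[OF mA(1) mB(1)] mA(2) mB(2) AB by simp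
qed

end

section \<open>The trapezoid rule and second differences\<close>

lemma has_integral_affine_unit:
  fixes p q c :: real
  shows "((\<lambda>x. p + q * (x - c)) has_integral (p + q / 2)) {c..c + 1}"
proof -
  have "((\<lambda>x. p + q * (x - c)) has_integral
      ((p * (c + 1) + q / 2 * (c + 1 - c)\<^sup>2) - (p * c + q / 2 * (c - c)\<^sup>2))) {c..c + 1}"
    by (rule fundamental_theorem_of_calculus[where f = "\<lambda>x. p * x + q / 2 * (x - c)\<^sup>2"])
      (auto simp flip: has_real_derivative_iff_has_vector_derivative intro!: derivative_eq_intros)
  thus ?thesis by (simp add: algebra_simps)
qed

lemma integral_ge_trapezoid:
  fixes F :: "real \<Rightarrow> real"
  assumes conc: "concave_on {c..c + 1} F" and cont: "continuous_on {c..c + 1} F"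
  shows "(F c + F (c + 1)) / 2 \<le> integral {c..c + 1} F"
proof -
  define ch where "ch x = F c + (F (c + 1) - F c) * (x - c)" for x
  have ch: "(ch has_integral (F c + F (c + 1)) / 2) {c..c + 1}"
    using has_integral_affine_unit[of "F c" "F (c + 1) - F c" c] unfolding ch_def
    by (rule has_integral_eq_rhs) (simp add: field_simps)
  have "ch x \<le> F x" if "x \<in> {c..c + 1}" for x
  proof -
    have "(1 - (x - c)) * F c + (x - c) * F (c + 1) \<le> F ((1 - (x - c)) *\<^sub>R c + (x - c) *\<^sub>R (c + 1))"
      using concave_onD[OF conc, of "x - c" c "c + 1"] that by simp
    also have "(1 - (x - c)) *\<^sub>R c + (x - c) *\<^sub>R (c + 1) = x" by (simp add: algebra_simps)
    finally show ?thesis by (simp add: ch_def algebra_simps)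
  qed
  thus ?thesis
    using has_integral_le[OF ch integrable_integral[OF integrable_continuous_interval[OF cont]]] by blast
qed

text \<open>
  To the right of \<open>c\<close> a concave function lies below the line through its points at \<open>c - 1\<close> and \<open>c\<close>.
\<close>

lemma integral_le_extended_chord:
  fixes F :: "real \<Rightarrow> real"
  assumes conc: "concave_on {c - 1..c + 1} F" and cont: "continuous_on {c - 1..c + 1} F"
  shows "integral {c..c + 1} F \<le> F c + (F c - F (c - 1)) / 2"
proof -
  define ch where "ch x = F c + (F c - F (c - 1)) * (x - c)" for x
  have ch: "(ch has_integral F c + (F c - F (c - 1)) / 2) {c..c + 1}"
    unfolding ch_def by (rule has_integral_affine_unit)
  have "F x \<le> ch x" if "x \<in> {c..c + 1}" for x
  proof -
    define u where "u = x - c"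
    define t where "t = u / (1 + u)"
    have u: "0 \<le> u" "u \<le> 1" using that by (auto simp: u_def)
    have t: "0 \<le> t" "t \<le> 1" using u by (auto simp: t_def)
    have t1: "1 - t = 1 / (1 + u)" using u by (simp add: t_def field_simps)
    have "(1 - t) *\<^sub>R x + t *\<^sub>R (c - 1) = (c + u) * (1 / (1 + u)) + (u / (1 + u)) * (c - 1)"
      unfolding t1 by (simp add: t_def u_def)
    also have "\<dots> = c * (1 + u) / (1 + u)"
      by (simp add: algebra_simps flip: add_divide_distrib diff_divide_distrib)
    also have "\<dots> = c" using u by simp
    finally have e: "(1 - t) *\<^sub>R x + t *\<^sub>R (c - 1) = c" .
    have "(1 - t) * F x + t * F (c - 1) \<le> F c"
      using concave_onD[OF conc t, of x "c - 1"] that unfolding e by simp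
    hence "F x * (1 / (1 + u)) + u / (1 + u) * F (c - 1) \<le> F c"
      unfolding t1 by (simp add: t_def mult.commute)
    hence "(1 + u) * (F x * (1 / (1 + u)) + u / (1 + u) * F (c - 1)) \<le> (1 + u) * F c"
      using u by (intro mult_left_mono) auto
    moreover have "(1 + u) * (F x * (1 / (1 + u)) + u / (1 + u) * F (c - 1)) = F x + u * F (c - 1)"
    proof -
      have "D * (p * (1 / D) + u / D * q) = p + u * q" if "D \<noteq> 0" for D p q :: real
        using that by (simp add: field_simps)
      from this[of "1 + u"] show ?thesis using u by simp
    qed
    ultimately show ?thesis by (simp add: ch_def u_def algebra_simps)
  qed
  moreover have "continuous_on {c..c + 1} F" by (rule continuous_on_subset[OF cont]) auto
  ultimately show ?thesis
    using has_integral_le[OF integrable_integral[OF integrable_continuous_interval] ch] by blast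
qed

text \<open>
  Each trapezoid has an error that is nonnegative by concavity, and that by the extended chord is at
  most half the decrease of the unit increment of \<open>F\<close> from one step to the next (on the first
  interval, monotonicity takes the place of the extended chord). These bounds telescope, so that the total error is controlled by the last increment alone: for a function with
  bounded slope it is \<open>O(1)\<close>, however many steps there are.
\<close>

lemma concave_trapezoid_rule:
  fixes F :: "real \<Rightarrow> real"
  assumes conc: "concave_on {0..real n} F" and cont: "continuous_on {0..real n} F"
    and anti: "antimono_on {0..real n} F"
  defines "T \<equiv> (\<lambda>n. integral {0..real n} F - (\<Sum>j=1..n. F (real j)) - (F 0 - F (real n)) / 2)"
  shows "0 \<le> T n" and "n > 0 \<Longrightarrow> T n \<le> (F (real n - 1) - F (real n)) / 2"
proof -
  have step: "T (Suc i) = T i + integral {real i..real i + 1} F - (F (real i) + F (real i + 1)) / 2"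
    if "Suc i \<le> n" for i
  proof -
    have "real i + 1 \<le> real n" using that by linarith
    hence "F integrable_on {0..real i + 1}"
      by (intro integrable_continuous_interval continuous_on_subset[OF cont]) auto
    hence "integral {0..real i + 1} F = integral {0..real i} F + integral {real i..real i + 1} F"
      by (intro Henstock_Kurzweil_Integration.integral_combine[symmetric]) auto
    moreover have "real (Suc i) = real i + 1" by simp
    moreover have "(\<Sum>j=1..Suc i. F (real j)) = (\<Sum>j=1..i. F (real j)) + F (real (Suc i))"
      by simp
    ultimately have "T (Suc i) = (integral {0..real i} F + integral {real i..real i + 1} F)
        - ((\<Sum>j=1..i. F (real j)) + F (real i + 1)) - (F 0 - F (real i + 1)) / 2"
      by (simp only: T_def)
    thus ?thesis unfolding T_def by argo
  qed
  have sub: "concave_on {x..y} F" "continuous_on {x..y} F" if "0 \<le> x" "y \<le> real n" for x y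
    using that conc unfolding concave_on_def
    by (auto intro: convex_on_subset continuous_on_subset[OF cont])
  have main: "0 \<le> T i \<and> (i > 0 \<longrightarrow> T i \<le> (F (real i - 1) - F (real i)) / 2)" if "i \<le> n" for i
    using that
  proof (induction i)
    case 0
    show ?case by (simp add: T_def)
  next
    case (Suc i)
    have i: "real i + 1 \<le> real n" using Suc.prems by linarith
    have lo: "(F (real i) + F (real i + 1)) / 2 \<le> integral {real i..real i + 1} F"
      using i by (intro integral_ge_trapezoid sub) auto
    have "T (Suc i) \<le> (F (real i) - F (real i + 1)) / 2"
    proof (cases "i = 0")
      case True
      have "integral {0..1} F \<le> integral {0..1::real} (\<lambda>_. F 0)"
      proof (rule Henstock_Kurzweil_Integration.integral_le)
        show "F integrable_on {0..1}" using i True by (intro integrable_continuous_interval sub) auto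
        show "F x \<le> F 0" if "x \<in> {0..1}" for x
          using anti that i True unfolding monotone_on_def by auto
      qed auto
      moreover have "T 0 = 0" by (simp add: T_def)
      ultimately show ?thesis using step[of i] Suc.prems True by (simp add: field_simps)
    next
      case False
      hence "integral {real i..real i + 1} F \<le> F (real i) + (F (real i) - F (real i - 1)) / 2"
        using i by (intro integral_le_extended_chord sub) auto
      moreover have "T i \<le> (F (real i - 1) - F (real i)) / 2" using Suc False by simp
      ultimately show ?thesis using step[of i] Suc.prems by (simp add: field_simps)
    qed
    moreover have "0 \<le> T (Suc i)" using step[of i] Suc lo by simp
    ultimately show ?case by (simp add: add.commute)
  qed
  from main[of n] show "0 \<le> T n" "n > 0 \<Longrightarrow> T n \<le> (F (real n - 1) - F (real n)) / 2" by auto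
qed

text \<open>
  The mean value theorem, applied twice to \<open>\<phi>\<close> and once to \<open>\<phi>'\<close>.
\<close>

lemma second_difference_nonpos:
  fixes \<phi> \<phi>' \<phi>'' :: "real \<Rightarrow> real"
  assumes d1: "\<And>x. x \<in> {a..b} \<Longrightarrow> (\<phi> has_real_derivative \<phi>' x) (at x within {a..b})"
    and d2: "\<And>x. x \<in> {a..b} \<Longrightarrow> (\<phi>' has_real_derivative \<phi>'' x) (at x within {a..b})"
    and neg: "\<And>x. x \<in> {a..b} \<Longrightarrow> \<phi>'' x \<le> 0"
    and x: "a \<le> x" "x + 2 * \<delta> \<le> b" and \<delta>: "0 < \<delta>"
  shows "\<phi> x + \<phi> (x + 2 * \<delta>) \<le> 2 * \<phi> (x + \<delta>)"
proof -
  have mvt: "\<exists>z. u < z \<and> z < v \<and> F v - F u = (v - u) * F' z"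
    if "u < v" "a \<le> u" "v \<le> b" "\<And>x. x \<in> {a..b} \<Longrightarrow> (F has_real_derivative F' x) (at x within {a..b})"
    for u v and F F' :: "real \<Rightarrow> real"
  proof -
    have "\<exists>z\<in>{u<..<v}. F v - F u = (\<lambda>h. h * F' z) (v - u)"
    proof (rule mvt_simple[OF that(1)])
      fix t assume "u \<le> t" "t \<le> v"
      hence "(F has_real_derivative F' t) (at t within {u..v})"
        using that by (intro has_field_derivative_subset[OF that(4)]) auto
      thus "(F has_derivative (\<lambda>h. h * F' t)) (at t within {u..v})"
        by (simp add: has_field_derivative_def mult_commute_abs)
    qed
    thus ?thesis by auto
  qed
  obtain z1 where z1: "x < z1" "z1 < x + \<delta>" "\<phi> (x + \<delta>) - \<phi> x = \<delta> * \<phi>' z1"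
    using mvt[of x "x + \<delta>" \<phi> \<phi>'] d1 x \<delta> by auto
  obtain z2 where z2: "x + \<delta> < z2" "z2 < x + 2 * \<delta>" "\<phi> (x + 2 * \<delta>) - \<phi> (x + \<delta>) = \<delta> * \<phi>' z2"
    using mvt[of "x + \<delta>" "x + 2 * \<delta>" \<phi> \<phi>'] d1 x \<delta> by auto
  obtain z where z: "z1 < z" "z < z2" "\<phi>' z2 - \<phi>' z1 = (z2 - z1) * \<phi>'' z"
    using mvt[of z1 z2 \<phi>' \<phi>''] d2 x z1 z2 by auto
  have "\<phi>'' z \<le> 0" using neg[of z] z z1 z2 x by auto
  hence "\<phi>' z2 \<le> \<phi>' z1" using z by (smt (verit) mult_nonneg_nonpos)
  hence "\<delta> * \<phi>' z2 \<le> \<delta> * \<phi>' z1" using \<delta> by (intro mult_left_mono) auto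
  thus ?thesis using z1 z2 by linarith
qed

text \<open>
  The second difference of \<open>x\<^sup>2\<close> is a constant, so adding a multiple of \<open>x\<^sup>2\<close> turns the bounds on \<open>f''\<close> into
  a sign condition.
\<close>

lemma C2_second_difference_bounds:
  assumes C2: "C2_on {0..a} f f' f''"
    and lo: "\<And>x. x \<in> {0..a} \<Longrightarrow> c \<le> - f'' x" and hi: "\<And>x. x \<in> {0..a} \<Longrightarrow> - f'' x \<le> d"
    and x: "0 \<le> x" "x + 2 * \<delta> \<le> a" and \<delta>: "0 < \<delta>"
  shows "c * \<delta>\<^sup>2 \<le> 2 * f (x + \<delta>) - f x - f (x + 2 * \<delta>)"
    and "2 * f (x + \<delta>) - f x - f (x + 2 * \<delta>) \<le> d * \<delta>\<^sup>2"
proof -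
  have d1: "\<And>x. x \<in> {0..a} \<Longrightarrow> (f has_real_derivative f' x) (at x within {0..a})"
    and d2: "\<And>x. x \<in> {0..a} \<Longrightarrow> (f' has_real_derivative f'' x) (at x within {0..a})"
    using C2 by (auto simp: C2_on_def)
  have "(f x + c / 2 * x\<^sup>2) + (f (x + 2 * \<delta>) + c / 2 * (x + 2 * \<delta>)\<^sup>2) \<le> 2 * (f (x + \<delta>) + c / 2 * (x + \<delta>)\<^sup>2)"
  proof (rule second_difference_nonpos[of 0 a "\<lambda>x. f x + c / 2 * x\<^sup>2" "\<lambda>x. f' x + c * x" "\<lambda>x. f'' x + c"])
    fix t assume t: "t \<in> {0..a}"
    show "((\<lambda>x. f x + c / 2 * x\<^sup>2) has_real_derivative f' t + c * t) (at t within {0..a})"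
      by (rule derivative_eq_intros d1[OF t] refl)+ simp
    show "((\<lambda>x. f' x + c * x) has_real_derivative f'' t + c) (at t within {0..a})"
      by (rule derivative_eq_intros d2[OF t] refl)+ simp
    show "f'' t + c \<le> 0" using lo[OF t] by simp
  qed (use x \<delta> in auto)
  thus "c * \<delta>\<^sup>2 \<le> 2 * f (x + \<delta>) - f x - f (x + 2 * \<delta>)"
    by (simp add: power2_eq_square algebra_simps)
  have "(- f x - d / 2 * x\<^sup>2) + (- f (x + 2 * \<delta>) - d / 2 * (x + 2 * \<delta>)\<^sup>2) \<le> 2 * (- f (x + \<delta>) - d / 2 * (x + \<delta>)\<^sup>2)"
  proof (rule second_difference_nonpos[of 0 a "\<lambda>x. - f x - d / 2 * x\<^sup>2" "\<lambda>x. - f' x - d * x" "\<lambda>x. - f'' x - d"])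
    fix t assume t: "t \<in> {0..a}"
    show "((\<lambda>x. - f x - d / 2 * x\<^sup>2) has_real_derivative - f' t - d * t) (at t within {0..a})"
      by (rule derivative_eq_intros d1[OF t] refl)+ simp
    show "((\<lambda>x. - f' x - d * x) has_real_derivative - f'' t - d) (at t within {0..a})"
      by (rule derivative_eq_intros d2[OF t] refl)+ simp
    show "- f'' t - d \<le> 0" using hi[OF t] by simp
  qed (use x \<delta> in auto)
  thus "2 * f (x + \<delta>) - f x - f (x + 2 * \<delta>) \<le> d * \<delta>\<^sup>2"
    by (simp add: power2_eq_square algebra_simps)
qed

section \<open>Counting by columns and rows\<close>

context decreasing_concave_curve
begin

lemma swap_mem_lattice_points:
  assumes r: "r > 0" and s: "s > 0"
  shows "(k, j) \<in> lattice_points L g r (1 / s) \<longleftrightarrow> (j, k) \<in> lattice_points L f r s"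
proof -
  define x y where "x = real j * s / r" and "y = real k * (1 / s) / r"
  have xy: "0 \<le> x" "0 \<le> y" using r s by (auto simp: x_def y_def)
  have 1: "real k \<le> r * s * f x \<longleftrightarrow> y \<le> f x"
    using r s by (simp add: y_def pos_divide_le_eq mult_ac)
  have 2: "real j \<le> r * (1 / s) * g y \<longleftrightarrow> x \<le> g y"
    using r s by (simp add: x_def pos_divide_le_eq pos_le_divide_eq mult_ac)
  have "y \<le> L \<and> x \<le> g y \<longleftrightarrow> x \<le> L \<and> y \<le> f x"
    using le_f_iff_le_g[of x y] f_in(2)[of x] g_in(2)[of y] xy by linarith
  thus ?thesis unfolding lattice_points_def using 1 2 by (auto simp: x_def y_def)
qed

lemma lattice_points_swap:
  assumes "r > 0" "s > 0"
  shows "lattice_points L f r s = prod.swap ` lattice_points L g r (1 / s)"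
  using swap_mem_lattice_points[OF assms] by (force simp: image_iff)

lemma lattice_count_swap:
  assumes "r > 0" "s > 0"
  shows "lattice_count L f r s = lattice_count L g r (1 / s)"
  unfolding lattice_count_def lattice_points_swap[OF assms] by (rule card_image) simp

lemma finite_points: "r > 0 \<Longrightarrow> s > 0 \<Longrightarrow> finite (lattice_points L f r s)"
  using f_maps by (intro finite_lattice_points) auto

lemma card_columns:
  assumes r: "r > 0" and s: "s > 0" and a: "0 \<le> a" "a \<le> L"
  defines "n \<equiv> nat \<lfloor>r * a / s\<rfloor>"
  shows "card {(j, k) \<in> lattice_points L f r s. j \<le> n} = (\<Sum>j=1..n. nat \<lfloor>r * s * f (real j * s / r)\<rfloor>)"
proof -
  have j: "real j * s / r \<le> a" if "j \<le> n" for j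
  proof -
    have "real j \<le> r * a / s" using that r s a unfolding n_def by (simp add: le_nat_floor le_nat_iff le_floor_iff)
    thus ?thesis using r s by (simp add: field_simps)
  qed
  have k: "k \<le> nat \<lfloor>z\<rfloor> \<longleftrightarrow> real k \<le> z" if "0 \<le> z" for k :: nat and z :: real
    using that by (simp add: le_nat_iff le_floor_iff)
  have "{(j, k) \<in> lattice_points L f r s. j \<le> n} = Sigma {1..n} (\<lambda>j. {1..nat \<lfloor>r * s * f (real j * s / r)\<rfloor>})"
  proof -
    have "(j, k) \<in> lattice_points L f r s \<and> j \<le> n
        \<longleftrightarrow> j \<in> {1..n} \<and> k \<in> {1..nat \<lfloor>r * s * f (real j * s / r)\<rfloor>}" for j k
    proof (cases "j \<le> n")
      case True
      have "0 \<le> r * s * f (real j * s / r)" using f_in(1)[of "real j * s / r"] j[OF True] a r s by simp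
      thus ?thesis using j[OF True] a True by (auto simp: lattice_points_def k)
    qed auto
    thus ?thesis by auto
  qed
  thus ?thesis by (simp add: card_SigmaI)
qed

text \<open>
  Every lattice point under the curve lies in one of the first \<open>n\<close> columns or in one of the first \<open>m\<close>
  rows, because the point \<open>(a, f a)\<close> lies on the curve. The points counted twice fill the rectangle
  \<open>{1..n} \<times> {1..m}\<close>, and all points of that rectangle are under the curve.
\<close>

lemma lattice_count_split:
  assumes r: "r > 0" and s: "s > 0" and a: "0 \<le> a" "a \<le> L"
  defines "n \<equiv> nat \<lfloor>r * a / s\<rfloor>" and "m \<equiv> nat \<lfloor>r * s * f a\<rfloor>"
  shows "lattice_count L f r s + n * m
     = (\<Sum>j=1..n. nat \<lfloor>r * s * f (real j * s / r)\<rfloor>)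
       + (\<Sum>k=1..m. nat \<lfloor>r * (1 / s) * g (real k * (1 / s) / r)\<rfloor>)"
proof -
  interpret g: decreasing_concave_curve L g f by (rule swap)
  define P where "P = lattice_points L f r s"
  define A B where "A = {(j, k) \<in> P. j \<le> n}" and "B = {(j, k) \<in> P. k \<le> m}"
  have fin: "finite P" unfolding P_def using r s by (rule finite_points)
  have fa: "0 \<le> f a" "f a \<le> L" using f_in a by auto
  have nat_le: "k \<le> nat \<lfloor>z\<rfloor> \<longleftrightarrow> real k \<le> z" if "0 \<le> z" for k :: nat and z :: real
    using that by (simp add: le_nat_iff le_floor_iff)
  have jn: "j \<le> n \<longleftrightarrow> real j * s / r \<le> a" for j
    unfolding n_def using r s a by (subst nat_le) (auto simp: field_simps)
  have km: "k \<le> m \<longleftrightarrow> real k \<le> r * s * f a" for k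
    unfolding m_def using r s fa by (subst nat_le) auto
  have mono: "r * s * f y \<le> r * s * f x" if "0 \<le> x" "x \<le> y" "y \<le> L" for x y
    using f_le[OF that] r s by (intro mult_left_mono) auto
  have "P = A \<union> B"
  proof -
    have "j \<le> n \<or> k \<le> m" if "(j, k) \<in> P" for j k
    proof (rule ccontr)
      assume *: "\<not> (j \<le> n \<or> k \<le> m)"
      hence "a \<le> real j * s / r" by (simp add: jn)
      hence "r * s * f (real j * s / r) \<le> r * s * f a"
        using that a by (intro mono) (auto simp: P_def lattice_points_def)
      with that have "real k \<le> r * s * f a" by (auto simp: P_def lattice_points_def)
      with * show False by (simp add: km)
    qed
    thus ?thesis by (auto simp: A_def B_def)
  qed
  moreover have "A \<inter> B = {1..n} \<times> {1..m}"
  proof -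
    have mem: "(j, k) \<in> P" if "1 \<le> j" "1 \<le> k" "j \<le> n" "k \<le> m" for j k
    proof -
      have "real j * s / r \<le> a" "real k \<le> r * s * f a" using that by (auto simp: jn km)
      moreover from this have "r * s * f a \<le> r * s * f (real j * s / r)"
        using r s a by (intro mono) auto
      ultimately show ?thesis using that a unfolding P_def lattice_points_def by auto
    qed
    have pos: "1 \<le> j \<and> 1 \<le> k" if "(j, k) \<in> P" for j k
      using that by (simp add: P_def lattice_points_def)
    show ?thesis
    proof (intro equalityI subrelI)
      fix j k assume "(j, k) \<in> A \<inter> B"
      hence "(j, k) \<in> P" "j \<le> n" "k \<le> m" by (auto simp: A_def B_def)
      thus "(j, k) \<in> {1..n} \<times> {1..m}" using pos[of j k] by simp
    next
      fix j k assume "(j, k) \<in> {1..n} \<times> {1..m}"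
      thus "(j, k) \<in> A \<inter> B" using mem[of j k] by (simp add: A_def B_def)
    qed
  qed
  moreover have "finite A" by (rule finite_subset[OF _ fin]) (auto simp: A_def)
  moreover have "finite B" by (rule finite_subset[OF _ fin]) (auto simp: B_def)
  ultimately have "card A + card B = card P + card ({1..n} \<times> {1..m})"
    using card_Un_Int[of A B] by (simp only:)
  hence "card A + card B = card P + n * m" by simp
  moreover have "card A = (\<Sum>j=1..n. nat \<lfloor>r * s * f (real j * s / r)\<rfloor>)"
    unfolding A_def P_def n_def by (rule card_columns[OF r s a])
  moreover have "card B = (\<Sum>k=1..m. nat \<lfloor>r * (1 / s) * g (real k * (1 / s) / r)\<rfloor>)"
  proof -
    have m: "m = nat \<lfloor>r * f a / (1 / s)\<rfloor>" by (simp add: m_def mult_ac)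
    have "B = prod.swap ` {(k, j) \<in> lattice_points L g r (1 / s). k \<le> m}"
      unfolding B_def P_def using swap_mem_lattice_points[OF r s] by (force simp: image_iff)
    hence "card B = card {(k, j) \<in> lattice_points L g r (1 / s). k \<le> m}"
      by (simp add: card_image)
    also have "\<dots> = (\<Sum>k=1..m. nat \<lfloor>r * (1 / s) * g (real k * (1 / s) / r)\<rfloor>)"
      unfolding m by (rule g.card_columns) (use r s fa in auto)
    finally show ?thesis .
  qed
  ultimately show ?thesis by (simp add: lattice_count_def P_def)
qed

end

section \<open>Two-term asymptotics of the lattice count\<close>

text \<open>
  Write \<open>\<lfloor>F j\<rfloor>\<close> as \<open>F j\<close> minus its fractional part. The sum of the \<open>F j\<close> is an integral up to the
  trapezoid correction \<open>(F 0 - F n) / 2\<close> and a bounded error; the fractional parts sum to \<open>n/2\<close> up to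
  van der Corput's error. Replacing \<open>n\<close> by \<open>X\<close> costs \<open>O(K + 1)\<close> in each place except in the integral
  over \<open>[n, X]\<close>, whose main part \<open>(X - n) F X\<close> is kept: it can be as large as \<open>F X\<close>, and cancels only
  when columns and rows are combined.
\<close>

lemma sum_floor_under_concave:
  fixes F :: "real \<Rightarrow> real"
  assumes X: "0 \<le> X" and conc: "concave_on {0..X} F" and cont: "continuous_on {0..X} F"
    and anti: "antimono_on {0..X} F" and nonneg: "\<And>x. x \<in> {0..X} \<Longrightarrow> 0 \<le> F x"
    and lip: "\<And>x y. x \<in> {0..X} \<Longrightarrow> y \<in> {0..X} \<Longrightarrow> \<bar>F x - F y\<bar> \<le> K * \<bar>x - y\<bar>"
    and K: "0 \<le> K" and \<theta>: "0 < \<theta>" "\<theta> \<le> 1" and h: "1 \<le> h"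
    and sd: "\<And>x. 0 \<le> x \<Longrightarrow> x + 2 \<le> X \<Longrightarrow> \<theta> \<le> 2 * F (x + 1) - F x - F (x + 2)"
      "\<And>x. 0 \<le> x \<Longrightarrow> x + 2 \<le> X \<Longrightarrow> 2 * F (x + 1) - F x - F (x + 2) \<le> h * \<theta>"
  defines "n \<equiv> nat \<lfloor>X\<rfloor>"
  shows "\<bar>real (\<Sum>j=1..n. nat \<lfloor>F (real j)\<rfloor>)
      - (integral {0..X} F - (X - real n) * F X + F X / 2 - F 0 / 2 - X / 2)\<bar>
    \<le> 3 * K + 2 + 60 * h * (X * \<theta> powr (1/3) + \<theta> powr (-1/2))"
proof -
  have n: "real n \<le> X" "X < real n + 1" using X unfolding n_def by linarith+
  define E where "E = (\<Sum>i<n. (frac (F (real i)) - 1 / 2))"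
  have "\<bar>E\<bar> \<le> 60 * h * (real n * \<theta> powr (1/3) + \<theta> powr (-1/2))"
    unfolding E_def
  proof (rule sum_frac_second_difference[OF \<theta> h])
    fix i assume i: "i + 2 \<le> n"
    have "real i + 2 = real (i + 2)" by simp
    also have "\<dots> \<le> real n" using i by (simp only: of_nat_le_iff)
    finally have "real i + 2 \<le> X" using n by simp
    from sd[OF _ this]
    show "\<theta> \<le> 2 * F (real (i + 1)) - F (real i) - F (real (i + 2))"
      "2 * F (real (i + 1)) - F (real i) - F (real (i + 2)) \<le> h * \<theta>"
      by (simp_all add: add.commute)
  qed
  also have "\<dots> \<le> 60 * h * (X * \<theta> powr (1/3) + \<theta> powr (-1/2))"
    using n h by (intro mult_left_mono add_right_mono mult_right_mono) auto
  finally have E: "\<bar>E\<bar> \<le> 60 * h * (X * \<theta> powr (1/3) + \<theta> powr (-1/2))" .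
  have floors: "real (\<Sum>j=1..n. nat \<lfloor>F (real j)\<rfloor>) = (\<Sum>j=1..n. F (real j)) - (\<Sum>j=1..n. frac (F (real j)))"
  proof -
    have "real (nat \<lfloor>F (real j)\<rfloor>) = F (real j) - frac (F (real j))" if "j \<in> {1..n}" for j
    proof -
      have "0 \<le> F (real j)" using that n by (intro nonneg) auto
      thus ?thesis by (simp add: frac_def)
    qed
    thus ?thesis by (simp add: sum_subtractf)
  qed
  \<comment> \<open>Van der Corput's estimate runs over \<open>0, ..., n - 1\<close> instead of \<open>1, ..., n\<close>.\<close>
  have shift: "\<bar>(\<Sum>j=1..n. frac (F (real j))) - real n / 2 - E\<bar> \<le> 1"
  proof -
    have "(\<Sum>j=1..n. frac (F (real j))) + frac (F 0) = (\<Sum>i<n. frac (F (real i))) + frac (F (real n))"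
      by (induction n) auto
    moreover have "E = (\<Sum>i<n. frac (F (real i))) - real n / 2" by (simp add: E_def sum_subtractf)
    moreover have "0 \<le> frac (F 0)" "frac (F 0) < 1" "0 \<le> frac (F (real n))" "frac (F (real n)) < 1"
      by (auto simp: frac_lt_1)
    ultimately show ?thesis by linarith
  qed
  define T where "T = integral {0..real n} F - (\<Sum>j=1..n. F (real j)) - (F 0 - F (real n)) / 2"
  have T: "0 \<le> T" "T \<le> K"
  proof -
    have sub: "concave_on {0..real n} F" "continuous_on {0..real n} F" "antimono_on {0..real n} F"
      using conc n unfolding concave_on_def
      by (auto intro: convex_on_subset continuous_on_subset[OF cont] monotone_on_subset[OF anti])
    show "0 \<le> T" unfolding T_def by (rule concave_trapezoid_rule(1)[OF sub])
    show "T \<le> K"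
    proof (cases "n = 0")
      case True
      thus ?thesis using K by (simp add: T_def)
    next
      case False
      hence "T \<le> (F (real n - 1) - F (real n)) / 2" unfolding T_def by (intro concave_trapezoid_rule(2)[OF sub]) simp
      moreover have "\<bar>F (real n - 1) - F (real n)\<bar> \<le> K * \<bar>(real n - 1) - real n\<bar>"
        using n False by (intro lip) auto
      ultimately show ?thesis using K by simp
    qed
  qed
  have Fn: "F X \<le> F (real n)" "F (real n) \<le> F X + K"
  proof -
    show "F X \<le> F (real n)" using anti n X unfolding monotone_on_def by auto
    have "\<bar>F (real n) - F X\<bar> \<le> K * \<bar>real n - X\<bar>" using n X by (intro lip) auto
    also have "\<dots> \<le> K * 1" using n K by (intro mult_left_mono) auto
    finally show "F (real n) \<le> F X + K" by simp
  qed
  define J where "J = integral {real n..X} F"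
  have "F integrable_on {0..X}" using cont by (rule integrable_continuous_interval)
  hence split: "integral {0..X} F = integral {0..real n} F + J"
    unfolding J_def using n by (intro Henstock_Kurzweil_Integration.integral_combine[symmetric]) auto
  have int_n: "F integrable_on {real n..X}"
    using n by (intro integrable_continuous_interval continuous_on_subset[OF cont]) auto
  have J: "(X - real n) * F X \<le> J" "J \<le> (X - real n) * F X + K"
  proof -
    have "integral {real n..X} (\<lambda>_. F X) \<le> J"
      unfolding J_def using int_n anti n X
      by (intro Henstock_Kurzweil_Integration.integral_le) (auto simp: monotone_on_def)
    thus "(X - real n) * F X \<le> J" using n by simp
    have "J \<le> integral {real n..X} (\<lambda>_. F (real n))"
      unfolding J_def using int_n anti n X
      by (intro Henstock_Kurzweil_Integration.integral_le) (auto simp: monotone_on_def)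
    also have "\<dots> = (X - real n) * F (real n)" using n by simp
    also have "\<dots> \<le> (X - real n) * (F X + K)" using n Fn by (intro mult_left_mono) auto
    also have "\<dots> = (X - real n) * F X + (X - real n) * K" by (simp add: algebra_simps)
    also have "(X - real n) * K \<le> 1 * K" using n K by (intro mult_right_mono) auto
    finally show "J \<le> (X - real n) * F X + K" by simp
  qed
  define fr where "fr = (\<Sum>j=1..n. frac (F (real j)))"
  have "real (\<Sum>j=1..n. nat \<lfloor>F (real j)\<rfloor>)
      - (integral {0..X} F - (X - real n) * F X + F X / 2 - F 0 / 2 - X / 2)
     = - (J - (X - real n) * F X) - T + (F (real n) - F X) / 2 + (X - real n) / 2 - (fr - real n / 2)"
    unfolding floors split fr_def[symmetric] T_def by (simp add: field_simps)
  thus ?thesis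
    using J T Fn n E shift K unfolding fr_def[symmetric] abs_le_iff by (simp only: ) argo
qed

context decreasing_concave_curve
begin

lemma scaled_curve:
  assumes r: "0 < r" and s: "0 < s" and a: "0 \<le> a" "a \<le> L"
  defines "F \<equiv> (\<lambda>x. r * s * f (x * s / r))"
  shows "concave_on {0..r * a / s} F" and "continuous_on {0..r * a / s} F"
    and "antimono_on {0..r * a / s} F" and "\<And>x. x \<in> {0..r * a / s} \<Longrightarrow> 0 \<le> F x"
    and "integral {0..r * a / s} F = r\<^sup>2 * integral {0..a} f"
proof -
  have dom: "x * s / r \<in> {0..a}" if "x \<in> {0..r * a / s}" for x
    using that r s by (auto simp: field_simps)
  hence domL: "x * s / r \<in> {0..L}" if "x \<in> {0..r * a / s}" for x
    using that a by force
  show "concave_on {0..r * a / s} F"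
    unfolding concave_on_def
  proof (rule convex_onI)
    fix t x y :: real assume t: "0 < t" "t < 1" and xy: "x \<in> {0..r * a / s}" "y \<in> {0..r * a / s}"
    have "(1 - t) * f (x * s / r) + t * f (y * s / r) \<le> f ((1 - t) *\<^sub>R (x * s / r) + t *\<^sub>R (y * s / r))"
      using t by (intro concave_onD[OF f_concave] domL xy) auto
    also have "(1 - t) *\<^sub>R (x * s / r) + t *\<^sub>R (y * s / r) = ((1 - t) *\<^sub>R x + t *\<^sub>R y) * s / r"
      using r by (simp add: field_simps)
    finally have "r * s * ((1 - t) * f (x * s / r) + t * f (y * s / r))
        \<le> r * s * f (((1 - t) *\<^sub>R x + t *\<^sub>R y) * s / r)"
      using r s by (intro mult_left_mono) auto
    thus "- F ((1 - t) *\<^sub>R x + t *\<^sub>R y) \<le> (1 - t) * - F x + t * - F y"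
      by (simp add: F_def algebra_simps)
  qed simp
  show "continuous_on {0..r * a / s} F"
    unfolding F_def
    by (intro continuous_intros continuous_on_compose2[OF f_cont]) (use domL r in auto)
  show "antimono_on {0..r * a / s} F"
  proof (rule monotone_onI)
    fix x y assume xy: "x \<in> {0..r * a / s}" "y \<in> {0..r * a / s}" "x \<le> y"
    have "x * s / r \<le> y * s / r" using xy r s by (intro divide_right_mono mult_right_mono) auto
    hence "f (y * s / r) \<le> f (x * s / r)" using domL[OF xy(1)] domL[OF xy(2)] by (intro f_le) auto
    thus "F x \<ge> F y" unfolding F_def using r s by (intro mult_left_mono) auto
  qed
  show "0 \<le> F x" if "x \<in> {0..r * a / s}" for x
    using f_in(1)[of "x * s / r"] domL[OF that] r s by (simp add: F_def)
  have "(f has_integral integral {0..a} f) {0..a}"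
    using a by (intro integrable_integral integrable_continuous_interval continuous_on_subset[OF f_cont]) auto
  from has_integral_stretch_real[OF this, of "s / r"]
  have "((\<lambda>x. f (s / r * x)) has_integral (r / s) * integral {0..a} f) ((\<lambda>x. x / (s / r)) ` {0..a})"
    using r s by simp
  moreover have "(\<lambda>x. x / (s / r)) ` {0..a} = {0..r * a / s}"
    using image_mult_atLeastAtMost[of "r / s" 0 a] r s by (simp add: image_def mult_ac)
  ultimately have "((\<lambda>x. f (s / r * x)) has_integral (r / s) * integral {0..a} f) {0..r * a / s}" by simp
  from has_integral_mult_right[OF this, of "r * s"]
  have "((\<lambda>x. r * s * f (s / r * x)) has_integral r\<^sup>2 * integral {0..a} f) {0..r * a / s}"
    using r s by (simp add: power2_eq_square mult.assoc)
  moreover have "(\<lambda>x. r * s * f (s / r * x)) = F" by (simp add: F_def mult_ac)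
  ultimately show "integral {0..r * a / s} F = r\<^sup>2 * integral {0..a} f" by (simp add: integral_unique)
qed

text \<open>
  The scaled function \<open>x \<mapsto> r s f (s x / r)\<close> has slopes bounded by \<open>S\<^sup>2 B\<close> and, as \<open>- f''\<close> lies between
  positive constants \<open>c\<close> and \<open>d\<close>, second differences of order \<open>1/r\<close>, between \<open>\<theta> = c / (S\<^sup>3 r)\<close> and \<open>h \<theta>\<close>.
  As there are \<open>O(r)\<close> columns, the error \<open>X \<theta> powr (1/3) + \<theta> powr (-1/2)\<close> is \<open>O(r powr (2/3))\<close>.
\<close>

lemma column_sum_asymptotics:
  assumes \<alpha>: "0 < \<alpha>" "\<alpha> \<le> L" and C2: "C2_on {0..\<alpha>} f f' f''"
    and neg: "\<forall>x\<in>{0..\<alpha>}. f'' x < 0" and S: "1 \<le> S"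
  shows "\<exists>C r\<^sub>0. \<forall>r\<ge>r\<^sub>0. \<forall>s\<in>{1 / S..S}. r \<ge> 1 \<longrightarrow>
    \<bar>real (\<Sum>j=1..nat \<lfloor>r * \<alpha> / s\<rfloor>. nat \<lfloor>r * s * f (real j * s / r)\<rfloor>)
      - (r\<^sup>2 * integral {0..\<alpha>} f - (r * \<alpha> / s - real (nat \<lfloor>r * \<alpha> / s\<rfloor>)) * (r * s * f \<alpha>)
         + r * s * f \<alpha> / 2 - r * s * L / 2 - r * \<alpha> / s / 2)\<bar> \<le> C * r powr (2/3)"
proof -
  have d1: "\<And>x. x \<in> {0..\<alpha>} \<Longrightarrow> (f has_real_derivative f' x) (at x within {0..\<alpha>})"
    and d2: "\<And>x. x \<in> {0..\<alpha>} \<Longrightarrow> (f' has_real_derivative f'' x) (at x within {0..\<alpha>})"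
    and cont: "continuous_on {0..\<alpha>} f''"
    using C2 by (auto simp: C2_on_def)
  have ne: "{0..\<alpha>} \<noteq> {}" using \<alpha> by auto
  obtain p where p: "p \<in> {0..\<alpha>}" "\<And>x. x \<in> {0..\<alpha>} \<Longrightarrow> f'' x \<le> f'' p"
    using continuous_attains_sup[OF compact_Icc ne cont] by blast
  obtain q where q: "q \<in> {0..\<alpha>}" "\<And>x. x \<in> {0..\<alpha>} \<Longrightarrow> f'' q \<le> f'' x"
    using continuous_attains_inf[OF compact_Icc ne cont] by blast
  define c d where "c = - f'' p" and "d = - f'' q"
  have c: "0 < c" using neg p by (auto simp: c_def)
  have cd: "c \<le> d" using p(2)[OF q(1)] by (simp add: c_def d_def)
  have "continuous_on {0..\<alpha>} f'" using d2 by (rule DERIV_continuous_on)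
  hence "bounded (f' ` {0..\<alpha>})" by (intro compact_imp_bounded compact_continuous_image compact_Icc)
  then obtain B where B: "\<And>x. x \<in> {0..\<alpha>} \<Longrightarrow> \<bar>f' x\<bar> \<le> B"
    unfolding bounded_iff real_norm_def by blast
  have B0: "0 \<le> B" using B[OF p(1)] by linarith
  have lip: "\<bar>f x - f y\<bar> \<le> B * \<bar>x - y\<bar>" if "x \<in> {0..\<alpha>}" "y \<in> {0..\<alpha>}" for x y
    using field_differentiable_bound[of "{0..\<alpha>}" f f' B x y] d1 B that by simp
  define \<theta>0 h K where "\<theta>0 = c / S ^ 3" and "h = d * S ^ 6 / c" and "K = S\<^sup>2 * B"
  define C where "C = 3 * K + 2 + 60 * h * (\<alpha> * S * \<theta>0 powr (1/3) + \<theta>0 powr (-1/2))"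
  have \<theta>0: "0 < \<theta>0" using c S by (simp add: \<theta>0_def)
  have h: "1 \<le> h"
  proof -
    have "c * 1 \<le> d * S ^ 6" using cd c S by (intro mult_mono one_le_power) auto
    thus ?thesis using c by (simp add: h_def)
  qed
  have K: "0 \<le> K" using B0 by (simp add: K_def)
  show ?thesis
  proof (rule exI[of _ C], rule exI[of _ \<theta>0], intro allI ballI impI)
    fix r s :: real assume r: "r \<ge> \<theta>0" "r \<ge> 1" and s_in: "s \<in> {1 / S..S}"
    have r0: "0 < r" using r by simp
    have s: "0 < s" "1 / S \<le> s" "s \<le> S" using s_in S by (auto intro: less_le_trans[of 0 "1 / S"])
    define F where "F x = r * s * f (x * s / r)" for x
    define X where "X = r * \<alpha> / s"
    define \<theta> where "\<theta> = \<theta>0 / r"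
    have \<theta>: "0 < \<theta>" "\<theta> \<le> 1" using \<theta>0 r r0 by (auto simp: \<theta>_def)
    note F = scaled_curve[OF r0 s(1) less_imp_le[OF \<alpha>(1)] \<alpha>(2), folded F_def X_def]
    have X0: "0 \<le> X" using r0 s \<alpha> by (simp add: X_def)
    have dom: "x * s / r \<in> {0..\<alpha>}" if "x \<in> {0..X}" for x
      using that r0 s by (auto simp: X_def field_simps)
    have lipF: "\<bar>F x - F y\<bar> \<le> K * \<bar>x - y\<bar>" if "x \<in> {0..X}" "y \<in> {0..X}" for x y
    proof -
      have "\<bar>F x - F y\<bar> = r * s * \<bar>f (x * s / r) - f (y * s / r)\<bar>"
        using r0 s by (simp add: F_def abs_mult flip: right_diff_distrib)
      also have "\<dots> \<le> r * s * (B * \<bar>x * s / r - y * s / r\<bar>)"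
        using r0 s by (intro mult_left_mono lip dom that) auto
      also have "\<bar>x * s / r - y * s / r\<bar> = \<bar>x - y\<bar> * s / r"
        using r0 s by (simp add: abs_mult flip: diff_divide_distrib left_diff_distrib)
      also have "r * s * (B * (\<bar>x - y\<bar> * s / r)) = s\<^sup>2 * (B * \<bar>x - y\<bar>)"
        using r0 by (simp add: power2_eq_square)
      also have "\<dots> \<le> S\<^sup>2 * (B * \<bar>x - y\<bar>)"
        using s B0 by (intro mult_right_mono power_mono) auto
      finally show ?thesis by (simp add: K_def)
    qed
    have sd: "\<theta> \<le> 2 * F (x + 1) - F x - F (x + 2)"
      "2 * F (x + 1) - F x - F (x + 2) \<le> h * \<theta>" if x: "0 \<le> x" "x + 2 \<le> X" for x
    proof -
      define u \<delta> where "u = x * s / r" and "\<delta> = s / r"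
      define D where "D = 2 * f (u + \<delta>) - f u - f (u + 2 * \<delta>)"
      have "(x + 2) * s / r \<in> {0..\<alpha>}" using x by (intro dom) auto
      hence u2: "u + 2 * \<delta> \<le> \<alpha>" by (simp add: u_def \<delta>_def add_divide_distrib distrib_right)
      have u0: "0 \<le> u" "0 < \<delta>" using x r0 s by (auto simp: u_def \<delta>_def)
      have lo: "c \<le> - f'' x" and hi: "- f'' x \<le> d" if "x \<in> {0..\<alpha>}" for x
        using p(2)[OF that] q(2)[OF that] by (auto simp: c_def d_def)
      have D: "c * \<delta>\<^sup>2 \<le> D" "D \<le> d * \<delta>\<^sup>2"
        unfolding D_def by (intro C2_second_difference_bounds[OF C2 lo hi u0(1) u2 u0(2)]; assumption)+
      have eq: "2 * F (x + 1) - F x - F (x + 2) = r * s * D"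
        by (simp add: F_def D_def u_def \<delta>_def add_divide_distrib algebra_simps)
      have s3: "s ^ 3 \<le> S ^ 3" using s by (intro power_mono) auto
      have scale: "r * s * (e * \<delta>\<^sup>2) = e * s ^ 3 / r" for e
        using r0 by (simp add: \<delta>_def power2_eq_square power3_eq_cube)
      have "\<theta> = c * (1 / S) ^ 3 / r" by (simp add: \<theta>_def \<theta>0_def power_one_over)
      also have "\<dots> \<le> c * s ^ 3 / r"
        using s S c r0 by (intro divide_right_mono mult_left_mono power_mono) auto
      also have "\<dots> \<le> r * s * D"
        unfolding scale[symmetric] using D r0 s by (intro mult_left_mono) auto
      finally show "\<theta> \<le> 2 * F (x + 1) - F x - F (x + 2)" unfolding eq .
      have "r * s * D \<le> d * s ^ 3 / r"
        unfolding scale[symmetric] using D r0 s by (intro mult_left_mono) auto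
      also have "\<dots> \<le> d * S ^ 3 / r"
        using s3 c cd r0 by (intro divide_right_mono mult_left_mono) auto
      also have "\<dots> = h * \<theta>"
      proof -
        have "S ^ 6 / S ^ 3 = S ^ 3" using power_diff[of S 3 6] S by simp
        moreover have "h * \<theta> = d * (S ^ 6 / S ^ 3) / r"
          using c unfolding h_def \<theta>_def \<theta>0_def by simp
        ultimately show ?thesis by (simp only:)
      qed
      finally show "2 * F (x + 1) - F x - F (x + 2) \<le> h * \<theta>" unfolding eq .
    qed
    have FX: "F X = r * s * f \<alpha>" "F 0 = r * s * L"
      using r0 s by (simp_all add: F_def X_def f_0)
    have "\<bar>real (\<Sum>j=1..nat \<lfloor>X\<rfloor>. nat \<lfloor>F (real j)\<rfloor>)
        - (integral {0..X} F - (X - real (nat \<lfloor>X\<rfloor>)) * F X + F X / 2 - F 0 / 2 - X / 2)\<bar>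
      \<le> 3 * K + 2 + 60 * h * (X * \<theta> powr (1/3) + \<theta> powr (-1/2))"
      by (rule sum_floor_under_concave[OF X0 F(1-4) lipF K \<theta> h sd])
    also have "\<dots> \<le> C * r powr (2/3)"
    proof -
      have "X = r * \<alpha> * (1 / s)" by (simp add: X_def)
      also have "1 / s \<le> S" using s S by (simp add: field_simps)
      hence "r * \<alpha> * (1 / s) \<le> r * \<alpha> * S" using r0 \<alpha> by (intro mult_left_mono) auto
      finally have "X * \<theta> powr (1/3) \<le> r * \<alpha> * S * \<theta> powr (1/3)" by (intro mult_right_mono) auto
      also have "\<dots> = r * \<alpha> * S * (\<theta>0 powr (1/3) / r powr (1/3))"
        using \<theta>0 r0 by (simp add: \<theta>_def powr_divide)
      also have "\<dots> = \<alpha> * S * \<theta>0 powr (1/3) * (r powr 1 / r powr (1/3))"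
        using r0 by simp
      also have "r powr 1 / r powr (1/3) = r powr (2/3)" by (subst powr_diff[symmetric]) simp
      finally have 1: "X * \<theta> powr (1/3) \<le> \<alpha> * S * \<theta>0 powr (1/3) * r powr (2/3)" .
      have "\<theta> powr (-1/2) = \<theta>0 powr (-1/2) * r powr (1/2)"
        using \<theta>0 r0 by (simp add: \<theta>_def powr_divide powr_minus_divide)
      also have "\<dots> \<le> \<theta>0 powr (-1/2) * r powr (2/3)"
        using r by (intro mult_left_mono powr_mono) auto
      finally have "X * \<theta> powr (1/3) + \<theta> powr (-1/2)
          \<le> (\<alpha> * S * \<theta>0 powr (1/3) + \<theta>0 powr (-1/2)) * r powr (2/3)"
        using 1 by (simp add: distrib_right)
      hence "60 * h * (X * \<theta> powr (1/3) + \<theta> powr (-1/2))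
          \<le> 60 * h * ((\<alpha> * S * \<theta>0 powr (1/3) + \<theta>0 powr (-1/2)) * r powr (2/3))"
        using h by (intro mult_left_mono) auto
      moreover have "(3 * K + 2) * 1 \<le> (3 * K + 2) * r powr (2/3)"
        using K r by (intro mult_left_mono ge_one_powr_ge_zero) auto
      ultimately show ?thesis by (simp add: C_def algebra_simps)
    qed
    finally show "\<bar>real (\<Sum>j=1..nat \<lfloor>r * \<alpha> / s\<rfloor>. nat \<lfloor>r * s * f (real j * s / r)\<rfloor>)
      - (r\<^sup>2 * integral {0..\<alpha>} f - (r * \<alpha> / s - real (nat \<lfloor>r * \<alpha> / s\<rfloor>)) * (r * s * f \<alpha>)
         + r * s * f \<alpha> / 2 - r * s * L / 2 - r * \<alpha> / s / 2)\<bar> \<le> C * r powr (2/3)"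
      unfolding F(5) FX unfolding F_def X_def .
  qed
qed

text \<open>
  Columns up to \<open>X = r \<alpha> / s\<close> plus rows up to \<open>Y = r s \<beta>\<close> minus the rectangle counted twice. The edge terms
  \<open>Y/2\<close> and \<open>X/2\<close> of the two sums cancel, their integrals combine to \<open>r\<^sup>2\<close> times the area plus \<open>X Y\<close>, and
  what remains of the terms at the corner \<open>(X, Y)\<close> is \<open>- (X - n) (Y - m)\<close>, which is bounded.
\<close>

lemma lattice_count_uniform_asymptotics:
  assumes \<alpha>: "0 < \<alpha>" "\<alpha> \<le> L" and \<beta>: "f \<alpha> = \<beta>" "0 < \<beta>"
    and f: "C2_on {0..\<alpha>} f f' f''" "\<forall>x\<in>{0..\<alpha>}. f'' x < 0"
    and g: "C2_on {0..\<beta>} g g' g''" "\<forall>y\<in>{0..\<beta>}. g'' y < 0" and S: "1 \<le> S"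
  shows "\<exists>C r\<^sub>0. \<forall>r\<ge>r\<^sub>0. \<forall>s\<in>{1 / S..S}. r \<ge> 1 \<longrightarrow>
    \<bar>real (lattice_count L f r s) - (r\<^sup>2 * Area L f - r * L * (s + 1 / s) / 2)\<bar> \<le> C * r powr (2/3)"
proof -
  interpret g: decreasing_concave_curve L g f by (rule swap)
  have \<beta>L: "\<beta> \<le> L" using f_in(2)[of \<alpha>] \<alpha> \<beta> by simp
  have g\<beta>: "g \<beta> = \<alpha>" using g_f \<alpha> \<beta> by auto
  obtain C1 r1 where 1: "\<And>r s. r \<ge> r1 \<Longrightarrow> s \<in> {1 / S..S} \<Longrightarrow> r \<ge> 1 \<Longrightarrow>
    \<bar>real (\<Sum>j=1..nat \<lfloor>r * \<alpha> / s\<rfloor>. nat \<lfloor>r * s * f (real j * s / r)\<rfloor>)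
      - (r\<^sup>2 * integral {0..\<alpha>} f - (r * \<alpha> / s - real (nat \<lfloor>r * \<alpha> / s\<rfloor>)) * (r * s * f \<alpha>)
         + r * s * f \<alpha> / 2 - r * s * L / 2 - r * \<alpha> / s / 2)\<bar> \<le> C1 * r powr (2/3)"
    using column_sum_asymptotics[OF \<alpha> f S] by blast
  obtain C2 r2 where 2: "\<And>r s. r \<ge> r2 \<Longrightarrow> s \<in> {1 / S..S} \<Longrightarrow> r \<ge> 1 \<Longrightarrow>
    \<bar>real (\<Sum>j=1..nat \<lfloor>r * \<beta> / s\<rfloor>. nat \<lfloor>r * s * g (real j * s / r)\<rfloor>)
      - (r\<^sup>2 * integral {0..\<beta>} g - (r * \<beta> / s - real (nat \<lfloor>r * \<beta> / s\<rfloor>)) * (r * s * g \<beta>)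
         + r * s * g \<beta> / 2 - r * s * L / 2 - r * \<beta> / s / 2)\<bar> \<le> C2 * r powr (2/3)"
    using g.column_sum_asymptotics[OF \<beta>(2) \<beta>L g S] by blast
  show ?thesis
  proof (rule exI[of _ "C1 + C2 + 1"], rule exI[of _ "max r1 r2"], intro allI ballI impI)
    fix r s :: real assume r: "max r1 r2 \<le> r" "1 \<le> r" and s_in: "s \<in> {1 / S..S}"
    have s0: "0 < s" using s_in S by (auto intro: less_le_trans[of 0 "1 / S"])
    have s_inv: "1 / s \<in> {1 / S..S}" using s_in S s0 by (auto simp: field_simps)
    define X Y where "X = r * \<alpha> / s" and "Y = r * s * \<beta>"
    define n m where "n = nat \<lfloor>X\<rfloor>" and "m = nat \<lfloor>Y\<rfloor>"
    have XY0: "0 \<le> X" "0 \<le> Y" using r s0 \<alpha> \<beta> by (auto simp: X_def Y_def)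
    have n: "real n \<le> X" "X \<le> real n + 1" using XY0 unfolding n_def by linarith+
    have m: "real m \<le> Y" "Y \<le> real m + 1" using XY0 unfolding m_def by linarith+
    define U V where "U = real (\<Sum>j=1..n. nat \<lfloor>r * s * f (real j * s / r)\<rfloor>)"
      and "V = real (\<Sum>k=1..m. nat \<lfloor>r * (1 / s) * g (real k * (1 / s) / r)\<rfloor>)"
    have U: "\<bar>U - (r\<^sup>2 * integral {0..\<alpha>} f - (X - real n) * Y + Y / 2 - r * s * L / 2 - X / 2)\<bar> \<le> C1 * r powr (2/3)"
      using 1[of r s] r s_in \<beta>(1) unfolding U_def n_def X_def Y_def by simp
    have Yeq: "r * \<beta> / (1 / s) = Y" "r * (1 / s) * g \<beta> = X" by (simp_all add: Y_def X_def g\<beta>)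
    have V: "\<bar>V - (r\<^sup>2 * integral {0..\<beta>} g - (Y - real m) * X + X / 2 - r * (1 / s) * L / 2 - Y / 2)\<bar> \<le> C2 * r powr (2/3)"
      using 2[of r "1 / s"] r s_inv unfolding Yeq V_def m_def by simp
    have "lattice_count L f r s + n * m
     = (\<Sum>j=1..n. nat \<lfloor>r * s * f (real j * s / r)\<rfloor>) + (\<Sum>k=1..m. nat \<lfloor>r * (1 / s) * g (real k * (1 / s) / r)\<rfloor>)"
      using lattice_count_split[of r s \<alpha>] r s0 \<alpha> \<beta> unfolding n_def m_def X_def Y_def by simp
    hence N: "real (lattice_count L f r s) = U + V - real n * real m"
      unfolding U_def V_def
      by (simp only: of_nat_add[symmetric] of_nat_mult[symmetric] diff_eq_eq eq_diff_eq)
    have XY: "X * Y = r\<^sup>2 * (\<alpha> * \<beta>)" using s0 by (simp add: X_def Y_def power2_eq_square)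
    have A: "r\<^sup>2 * Area L f = r\<^sup>2 * integral {0..\<alpha>} f + r\<^sup>2 * integral {0..\<beta>} g - X * Y"
    proof -
      have "Area L f = integral {0..\<alpha>} f + integral {0..\<beta>} g - \<alpha> * \<beta>"
        using area_split[of \<alpha>] \<alpha> \<beta> by simp
      thus ?thesis unfolding XY by (simp only: right_diff_distrib distrib_left)
    qed
    have "(X - real n) * (Y - real m) \<le> 1 * 1" using n m by (intro mult_mono) auto
    moreover have "0 \<le> (X - real n) * (Y - real m)" using n m by simp
    ultimately have prod: "0 \<le> (X - real n) * (Y - real m)" "(X - real n) * (Y - real m) \<le> 1"
      by simp_all
    have "r * L * (s + 1 / s) / 2 = r * s * L / 2 + r * (1 / s) * L / 2" by (simp add: field_simps)
    hence "real (lattice_count L f r s) - (r\<^sup>2 * Area L f - r * L * (s + 1 / s) / 2)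
      = (U - (r\<^sup>2 * integral {0..\<alpha>} f - (X - real n) * Y + Y / 2 - r * s * L / 2 - X / 2))
      + (V - (r\<^sup>2 * integral {0..\<beta>} g - (Y - real m) * X + X / 2 - r * (1 / s) * L / 2 - Y / 2))
      - (X - real n) * (Y - real m)"
      unfolding N A by (simp add: algebra_simps)
    moreover have "1 \<le> r powr (2/3)" using r by (intro ge_one_powr_ge_zero) auto
    moreover have "(C1 + C2 + 1) * r powr (2/3) = C1 * r powr (2/3) + C2 * r powr (2/3) + r powr (2/3)"
      by (simp add: algebra_simps)
    ultimately show "\<bar>real (lattice_count L f r s) - (r\<^sup>2 * Area L f - r * L * (s + 1 / s) / 2)\<bar>
        \<le> (C1 + C2 + 1) * r powr (2/3)"
      using U V prod unfolding abs_le_iff by linarith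
  qed
qed

end

section \<open>Optimal stretch factors\<close>

lemma optimal_stretch_iff:
  "s \<in> optimal_stretch L f r
    \<longleftrightarrow> 0 < s \<and> (\<forall>t>0. lattice_count L f r t \<le> lattice_count L f r s)"
  unfolding optimal_stretch_def is_arg_max_def mem_Collect_eq by (meson not_less)

context decreasing_concave_curve
begin

lemma Area_eq: "Area L f = integral {0..L} f" and Area_swap: "Area L g = Area L f"
proof -
  interpret g: decreasing_concave_curve L g f by (rule swap)
  show "Area L f = integral {0..L} f" using area_split[of L] L_pos f_L by simp
  show "Area L g = Area L f"
    using area_split[of 0] g.area_split[of L] L_pos f_0 g.f_L by simp
qed

lemma Area_pos: "0 < Area L f"
proof -
  have half: "0 < f (L / 2)" using f_less[of "L / 2" L] f_L L_pos by simp
  have "integral {0..L / 2} (\<lambda>_. f (L / 2)) \<le> integral {0..L / 2} f"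
  proof (rule Henstock_Kurzweil_Integration.integral_le)
    show "f integrable_on {0..L / 2}"
      using L_pos by (intro integrable_continuous_interval continuous_on_subset[OF f_cont]) auto
    show "f (L / 2) \<le> f x" if "x \<in> {0..L / 2}" for x
      by (rule f_le) (use that L_pos in auto)
  qed auto
  also have "\<dots> \<le> integral {0..L} f"
  proof (rule integral_subset_le)
    show "\<forall>x\<in>{0..L}. 0 \<le> f x" by (auto intro: f_in(1))
  qed (use L_pos in \<open>auto intro!: integrable_continuous_interval continuous_on_subset[OF f_cont]\<close>)
  finally have "integral {0..L / 2} (\<lambda>_. f (L / 2)) \<le> Area L f" unfolding Area_eq .
  moreover have "integral {0..L / 2} (\<lambda>_. f (L / 2)) = L / 2 * f (L / 2)" using L_pos by simp
  moreover have "0 < L / 2 * f (L / 2)" using half L_pos by simp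
  ultimately show ?thesis by linarith
qed

lemma lattice_count_columns:
  assumes r: "0 < r" and s: "0 < s"
  shows "lattice_count L f r s = (\<Sum>j=1..nat \<lfloor>r * L / s\<rfloor>. nat \<lfloor>r * s * f (real j * s / r)\<rfloor>)"
  using lattice_count_split[OF r s, of L] L_pos by (simp add: f_L)

text \<open>
  In a column count the sum of the \<open>F j\<close> falls short of the integral by \<open>(F 0 - F n) / 2\<close>, by concavity
  alone. As soon as there is one column, the last one lies beyond half the width of the curve, so
  this deficit is at least a constant times \<open>r s\<close>.
\<close>

lemma lattice_count_le:
  assumes r: "0 < r" and s: "0 < s" and wide: "s \<le> r * L"
  shows "real (lattice_count L f r s) \<le> r\<^sup>2 * Area L f - r * s * (L - f (L / 2)) / 2"
proof -
  define F where "F x = r * s * f (x * s / r)" for x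
  define X where "X = r * L / s"
  define n where "n = nat \<lfloor>X\<rfloor>"
  note F = scaled_curve[OF r s less_imp_le[OF L_pos] order.refl, folded F_def X_def]
  have X1: "1 \<le> X" using wide s by (simp add: X_def)
  have n: "real n \<le> X" "X < real n + 1" using X1 unfolding n_def by linarith+
  have "1 \<le> real n" using X1 unfolding n_def by simp
  hence half: "X / 2 \<le> real n" using n by linarith
  have "L / 2 \<le> real n * s / r" "real n * s / r \<le> L"
    using half n r s by (auto simp: X_def field_simps)
  hence "f (real n * s / r) \<le> f (L / 2)" using L_pos by (intro f_le) auto
  hence Fn: "F (real n) \<le> r * s * f (L / 2)" unfolding F_def using r s by (intro mult_left_mono) auto
  have "real (lattice_count L f r s) = (\<Sum>j=1..n. real (nat \<lfloor>F (real j)\<rfloor>))"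
    using lattice_count_columns[OF r s] by (simp add: n_def X_def F_def)
  also have "\<dots> \<le> (\<Sum>j=1..n. F (real j))"
    using F(4) n by (intro sum_mono of_nat_floor) auto
  also have "\<dots> \<le> integral {0..real n} F - (F 0 - F (real n)) / 2"
  proof -
    have "concave_on {0..real n} F" "continuous_on {0..real n} F" "antimono_on {0..real n} F"
      using F(1) n unfolding concave_on_def
      by (auto intro: convex_on_subset continuous_on_subset[OF F(2)] monotone_on_subset[OF F(3)])
    from concave_trapezoid_rule(1)[OF this] show ?thesis by linarith
  qed
  also have "integral {0..real n} F \<le> integral {0..X} F"
    using n F(4) X1
    by (intro integral_subset_le integrable_continuous_interval continuous_on_subset[OF F(2)]) auto
  also have "integral {0..X} F = r\<^sup>2 * Area L f" unfolding F(5) Area_eq ..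
  also have "r\<^sup>2 * Area L f - (F 0 - F (real n)) / 2 \<le> r\<^sup>2 * Area L f - r * s * (L - f (L / 2)) / 2"
    using Fn by (simp add: F_def f_0 right_diff_distrib)
  finally show ?thesis by simp
qed

text \<open>
  A large stretch loses at least a constant times \<open>r s\<close> of the area, but \<open>s = 1\<close> only loses \<open>O(r)\<close>.
\<close>

lemma near_optimal_stretch_bounded:
  assumes D: "\<And>r. r \<ge> r\<^sub>1 \<Longrightarrow> r\<^sup>2 * Area L f - r * D \<le> real (lattice_count L f r 1)"
  shows "\<exists>S r\<^sub>0. \<forall>r\<ge>r\<^sub>0. \<forall>s>0. lattice_count L f r 1 \<le> lattice_count L f r s \<longrightarrow> s \<le> S"
proof -
  define c where "c = (L - f (L / 2)) / 2"
  have c: "0 < c" using f_less[of 0 "L / 2"] f_0 L_pos by (simp add: c_def)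
  show ?thesis
  proof (rule exI[of _ "D / c"], rule exI[of _ "max 1 (max r\<^sub>1 ((\<bar>D\<bar> + 1) / Area L f))"], intro allI impI)
    fix r s :: real
    assume r: "max 1 (max r\<^sub>1 ((\<bar>D\<bar> + 1) / Area L f)) \<le> r" and s: "0 < s"
      and le: "lattice_count L f r 1 \<le> lattice_count L f r s"
    have r0: "0 < r" using r by simp
    have "r\<^sup>2 * Area L f - r * D \<le> real (lattice_count L f r 1)" using D r by simp
    also have "\<dots> \<le> real (lattice_count L f r s)" using le by simp
    finally have lo: "r\<^sup>2 * Area L f - r * D \<le> real (lattice_count L f r s)" .
    have "\<bar>D\<bar> + 1 \<le> r * Area L f" using r Area_pos by (simp add: pos_divide_le_eq)
    hence "D < r * Area L f" by linarith
    hence "r * D < r * (r * Area L f)" using r0 by (intro mult_strict_left_mono)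
    hence "0 < r\<^sup>2 * Area L f - r * D" by (simp add: power2_eq_square mult.assoc)
    with lo have pos: "0 < lattice_count L f r s" by linarith
    have "s \<le> r * L"
    proof (rule ccontr)
      assume "\<not> s \<le> r * L"
      hence "r * L / s < 1" using s by simp
      hence "nat \<lfloor>r * L / s\<rfloor> = 0" by linarith
      with pos show False unfolding lattice_count_columns[OF r0 s] by simp
    qed
    from lattice_count_le[OF r0 s this] lo have "r * (s * c) \<le> r * D"
      by (simp add: c_def field_simps)
    hence "s * c \<le> D" using r0 by simp
    thus "s \<le> D / c" using c by (simp add: pos_le_divide_eq)
  qed
qed

text \<open>
  The lower bound on the optimal stretch is the upper bound for the reflected curve, whose stretch
  is \<open>1 / s\<close>.
\<close>

lemma optimal_stretch_bounded:
  assumes D: "\<And>r. r \<ge> r\<^sub>1 \<Longrightarrow> r\<^sup>2 * Area L f - r * D \<le> real (lattice_count L f r 1)"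
  shows "\<exists>S\<ge>1. \<exists>r\<^sub>0. \<forall>r\<ge>r\<^sub>0. optimal_stretch L f r \<subseteq> {1 / S..S}"
proof -
  interpret g: decreasing_concave_curve L g f by (rule swap)
  obtain S r0 where 1: "\<And>r s. r \<ge> r0 \<Longrightarrow> 0 < s \<Longrightarrow> lattice_count L f r 1 \<le> lattice_count L f r s \<Longrightarrow> s \<le> S"
    using near_optimal_stretch_bounded[OF D] by blast
  have "\<exists>S r\<^sub>0. \<forall>r\<ge>r\<^sub>0. \<forall>s>0. lattice_count L g r 1 \<le> lattice_count L g r s \<longrightarrow> s \<le> S"
  proof (rule g.near_optimal_stretch_bounded[of "max 1 r\<^sub>1" D])
    fix r assume r: "max 1 r\<^sub>1 \<le> r"
    show "r\<^sup>2 * Area L g - r * D \<le> real (lattice_count L g r 1)"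
      using D[of r] r lattice_count_swap[of r 1] by (simp add: Area_swap)
  qed
  then obtain S' r0' where 2: "\<And>r s. r \<ge> r0' \<Longrightarrow> 0 < s \<Longrightarrow> lattice_count L g r 1 \<le> lattice_count L g r s \<Longrightarrow> s \<le> S'"
    by blast
  define M where "M = max 1 (max S S')"
  have M: "1 \<le> M" "S \<le> M" "S' \<le> M" by (auto simp: M_def)
  show ?thesis
  proof (rule exI[of _ M], intro conjI M(1), rule exI[of _ "max 1 (max r0 r0')"], intro allI impI subsetI)
    fix r s assume r: "max 1 (max r0 r0') \<le> r" and "s \<in> optimal_stretch L f r"
    hence s: "0 < s" "lattice_count L f r 1 \<le> lattice_count L f r s"
      by (auto simp: optimal_stretch_iff)
    have "s \<le> M" using 1[of r s] r s M by simp
    moreover have "1 / s \<le> M"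
      using 2[of r "1 / s"] r s M lattice_count_swap[of r s] lattice_count_swap[of r 1] by simp
    ultimately show "s \<in> {1 / M..M}" using s M by (simp add: field_simps)
  qed
qed

end

text \<open>
  Since \<open>s + 1 / s - 2 = (s - 1)\<^sup>2 / s\<close>, the second term \<open>- r L (s + 1/s) / 2\<close> has a nondegenerate maximum at
  \<open>s = 1\<close>. Therefore an error \<open>O(r powr (2/3))\<close> in the count, small compared with \<open>r\<close>, becomes the square
  root of the relative error \<open>O(r powr (-1/3))\<close> in the location of \<open>s\<close>.
\<close>

lemma stretch_deviation:
  assumes s: "0 < s" "s \<le> S" and E: "L * r * (s + 1 / s - 2) \<le> E * r powr (2/3)"
    and L: "0 < L" and r: "1 \<le> r" and E0: "0 \<le> E"
  shows "\<bar>s - 1\<bar> \<le> sqrt (S * E / L) * r powr (-1/6)"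
proof -
  define w where "w = L * r * (s + 1 / s - 2)"
  have "(s - 1)\<^sup>2 = s * w / (L * r)"
    unfolding w_def using s L r by (simp add: power2_eq_square field_simps)
  moreover have "s * w \<le> s * (E * r powr (2/3))"
    using E s unfolding w_def by (intro mult_left_mono) auto
  moreover have "s * (E * r powr (2/3)) \<le> S * (E * r powr (2/3))"
    using s E0 by (intro mult_right_mono) auto
  ultimately have "(s - 1)\<^sup>2 \<le> S * (E * r powr (2/3)) / (L * r)"
    using L r by (simp add: divide_right_mono)
  also have "\<dots> = S * E / L * (r powr (2/3) / r powr 1)" using r by simp
  also have "r powr (2/3) / r powr 1 = r powr (-1/3)" by (subst powr_diff[symmetric]) simp
  finally have "sqrt ((s - 1)\<^sup>2) \<le> sqrt (S * E / L * r powr (-1/3))" by (rule real_sqrt_le_mono)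
  also have "\<dots> = sqrt (S * E / L) * r powr (-1/6)"
    using r by (simp only: real_sqrt_mult) (simp add: powr_half_sqrt[symmetric] powr_powr)
  finally show ?thesis by simp
qed

lemma (in decreasing_concave_curve) max_lattice_count_eq:
  assumes r: "0 < r" and s: "s \<in> optimal_stretch L f r"
  shows "max_lattice_count L f r = lattice_count L f r s"
  unfolding max_lattice_count_def
proof (rule Max_eqI)
  show "finite (lattice_count L f r ` {0<..})"
    using f_maps r by (intro finite_range_lattice_count) auto
qed (use s in \<open>auto simp: optimal_stretch_iff\<close>)

theorem theorem3:
  fixes L \<alpha> \<beta> :: real and f f' f'' g g' g'' :: "real \<Rightarrow> real"
  assumes L_pos: "L > 0"
    and f_maps: "f \<in> {0..L} \<rightarrow> {0..L}"
    and f_cont: "continuous_on {0..L} f"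
    and f_concave: "concave_on {0..L} f"
    and f_decreasing: "strict_antimono_on {0..L} f"
    and f_0: "f 0 = L" and f_L: "f L = 0"
    and g_maps: "g \<in> {0..L} \<rightarrow> {0..L}"
    and g_f: "\<forall>x\<in>{0..L}. g (f x) = x"
    and f_g: "\<forall>y\<in>{0..L}. f (g y) = y"
    and point: "(\<alpha>, \<beta>) \<in> curve L f" and "\<alpha> > 0" and "\<beta> > 0"
    and f_C2: "C2_on {0..\<alpha>} f f' f''"
    and f'_neg: "\<forall>x\<in>{0<..\<alpha>}. f' x < 0"
    and f''_neg: "\<forall>x\<in>{0..\<alpha>}. f'' x < 0"
    and g_C2: "C2_on {0..\<beta>} g g' g''"
    and g'_neg: "\<forall>y\<in>{0<..\<beta>}. g' y < 0"
    and g''_neg: "\<forall>y\<in>{0..\<beta>}. g'' y < 0"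
    and f''_monotonic: "mono_on {0..\<alpha>} f'' \<or> antimono_on {0..\<alpha>} f''"
    and g''_monotonic: "mono_on {0..\<beta>} g'' \<or> antimono_on {0..\<beta>} g''"
  shows "(\<forall>s. (\<forall>\<^sub>F r in at_top. s r \<in> optimal_stretch L f r) \<longrightarrow> (s \<longlongrightarrow> 1) at_top) \<and>
    (\<exists>C>0. \<exists>r\<^sub>0>0. \<forall>r\<ge>r\<^sub>0. \<forall>s\<in>optimal_stretch L f r. \<bar>s - 1\<bar> \<le> C * r powr (-1/6)) \<and>
    (\<lambda>r. real (max_lattice_count L f r) - (r\<^sup>2 * Area L f - r * L)) \<in> O[at_top](\<lambda>r. r powr (2/3))"
proof -
  interpret decreasing_concave_curve L f g
    by (rule decreasing_concave_curve.intro) fact+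
  define N where "N = lattice_count L f"
  define main where "main r s = r\<^sup>2 * Area L f - r * L * (s + 1 / s) / 2" for r s
  have \<alpha>: "\<alpha> \<le> L" "f \<alpha> = \<beta>" using point by (auto simp: curve_def)
  \<comment> \<open>The range of stretch factors is only known after the asymptotics have been applied with \<open>S = 1\<close>,
    so \<open>S\<close> stays general here.\<close>
  have uniform: "\<exists>C r\<^sub>0. \<forall>r\<ge>r\<^sub>0. \<forall>s\<in>{1 / S..S}. r \<ge> 1 \<longrightarrow> \<bar>real (N r s) - main r s\<bar> \<le> C * r powr (2/3)"
    if "1 \<le> S" for S
    using lattice_count_uniform_asymptotics[OF \<open>0 < \<alpha>\<close> \<alpha> \<open>0 < \<beta>\<close> f_C2 f''_neg g_C2 g''_neg that]
    unfolding N_def main_def .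
  obtain C1 r1 where 1: "\<And>r. r \<ge> r1 \<Longrightarrow> r \<ge> 1 \<Longrightarrow> \<bar>real (N r 1) - main r 1\<bar> \<le> C1 * r powr (2/3)"
    using uniform[of 1] by auto
  have "r\<^sup>2 * Area L f - r * (L + \<bar>C1\<bar>) \<le> real (lattice_count L f r 1)" if r: "r \<ge> max 1 r1" for r
  proof -
    have "C1 * r powr (2/3) \<le> \<bar>C1\<bar> * r powr 1"
      using r by (intro mult_mono powr_mono) auto
    thus ?thesis using 1[of r] r by (simp add: main_def N_def abs_le_iff algebra_simps)
  qed
  from optimal_stretch_bounded[OF this] obtain S r2 where S: "1 \<le> S"
    and opt_S: "\<And>r. r \<ge> r2 \<Longrightarrow> optimal_stretch L f r \<subseteq> {1 / S..S}" by blast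
  obtain C r3 where C: "\<And>r s. r \<ge> r3 \<Longrightarrow> s \<in> {1 / S..S} \<Longrightarrow> r \<ge> 1 \<Longrightarrow>
      \<bar>real (N r s) - main r s\<bar> \<le> C * r powr (2/3)"
    using uniform[OF S] by blast
  define r0 where "r0 = max 1 (max r2 r3)"
  have r0: "1 \<le> r0" "r2 \<le> r0" "r3 \<le> r0" by (auto simp: r0_def)
  have C0: "0 \<le> C"
  proof -
    have "0 \<le> C * r0 powr (2/3)" using C[of r0 1] r0 S by (auto intro: order_trans[OF abs_ge_zero])
    thus ?thesis using r0 by (simp add: zero_le_mult_iff)
  qed
  have opt: "0 < s" "s \<in> {1 / S..S}" "N r 1 \<le> N r s" "max_lattice_count L f r = N r s"
    if r: "r \<ge> r0" and s: "s \<in> optimal_stretch L f r" for r s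
  proof -
    show "s \<in> {1 / S..S}" using opt_S[of r] r r0 s by auto
    show "max_lattice_count L f r = N r s" using max_lattice_count_eq[of r s] r r0 s by (simp add: N_def)
    show "0 < s" "N r 1 \<le> N r s" using s unfolding N_def by (simp_all add: optimal_stretch_iff)
  qed
  have main1: "main r 1 = r\<^sup>2 * Area L f - r * L" for r by (simp add: main_def)
  have main_diff: "main r 1 - main r s = L * r * (s + 1 / s - 2) / 2" for r s
    by (simp add: main_def field_simps)
  have lower: "main r 1 - C * r powr (2/3) \<le> real (N r 1)" if "r \<ge> r0" for r
    using C[of r 1] that r0 S by (auto simp: abs_le_iff)
  define K where "K = sqrt (S * (4 * C) / L) + 1"
  have K: "0 < K" using S C0 L_pos by (auto simp: K_def intro!: add_nonneg_pos)
  have close: "\<bar>s - 1\<bar> \<le> K * r powr (-1/6)" if r: "r \<ge> r0" and s: "s \<in> optimal_stretch L f r" for r s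
  proof -
    have "main r 1 - C * r powr (2/3) \<le> main r s + C * r powr (2/3)"
      using lower[OF r] opt[OF r s] C[of r s] r r0 by (auto simp: abs_le_iff)
    hence "L * r * (s + 1 / s - 2) \<le> 4 * C * r powr (2/3)" using main_diff[of r s] by simp
    hence "\<bar>s - 1\<bar> \<le> sqrt (S * (4 * C) / L) * r powr (-1/6)"
      using opt[OF r s] r r0 C0 L_pos by (intro stretch_deviation) auto
    moreover have "0 \<le> r powr (-1/6)" by simp
    ultimately show ?thesis unfolding K_def distrib_right mult_1 by linarith
  qed
  have small: "((\<lambda>r. K * r powr (-1/6)) \<longlongrightarrow> 0) at_top"
    by (intro tendsto_mult_right_zero tendsto_neg_powr filterlim_ident) auto
  have "(s \<longlongrightarrow> 1) at_top" if ev: "\<forall>\<^sub>F r in at_top. s r \<in> optimal_stretch L f r" for s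
  proof -
    have "\<forall>\<^sub>F r in at_top. norm (s r - 1) \<le> K * r powr (-1/6)"
      using ev eventually_ge_at_top[of r0] by eventually_elim (use close in auto)
    hence "((\<lambda>r. s r - 1) \<longlongrightarrow> 0) at_top" by (rule Lim_null_comparison) (rule small)
    thus ?thesis by (simp add: LIM_zero_iff)
  qed
  moreover have "\<exists>C>0. \<exists>r\<^sub>0>0. \<forall>r\<ge>r\<^sub>0. \<forall>s\<in>optimal_stretch L f r. \<bar>s - 1\<bar> \<le> C * r powr (-1/6)"
    using K r0 close by (intro exI[of _ K] exI[of _ r0] conjI) auto
  moreover have "(\<lambda>r. real (max_lattice_count L f r) - (r\<^sup>2 * Area L f - r * L)) \<in> O[at_top](\<lambda>r. r powr (2/3))"
  proof (rule bigoI[where c = C])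
    show "\<forall>\<^sub>F r in at_top. norm (real (max_lattice_count L f r) - (r\<^sup>2 * Area L f - r * L)) \<le> C * norm (r powr (2/3))"
      using eventually_ge_at_top[of r0]
    proof eventually_elim
      case (elim r)
      have "optimal_stretch L f r \<noteq> {}"
        using f_maps elim r0 by (intro optimal_stretch_nonempty) auto
      then obtain s where s: "s \<in> optimal_stretch L f r" by blast
      note s' = opt[OF elim s]
      have "2 \<le> s + 1 / s"
      proof -
        have "0 \<le> (s - 1)\<^sup>2 / s" using s' by simp
        also have "\<dots> = s + 1 / s - 2" using s' by (simp add: power2_eq_square field_simps)
        finally show ?thesis by simp
      qed
      hence "0 \<le> L * r * (s + 1 / s - 2)" using L_pos elim r0 by simp
      hence "main r s \<le> main r 1" using main_diff[of r s] by simp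
      moreover have "real (N r s) \<le> main r s + C * r powr (2/3)"
        using C[of r s] s' elim r0 by (auto simp: abs_le_iff)
      moreover have "main r 1 - C * r powr (2/3) \<le> real (N r s)" using lower[OF elim] s' by simp
      ultimately show ?case unfolding s'(4) main1[symmetric] by (simp add: abs_le_iff)
    qed
  qed
  ultimately show ?thesis by blast
qed

end
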